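(* Let $1<p<\infty$ and $k$ a positive integer. Then there is $c=c_{n,p,k}>0$ such that \[ \|M^k\|_{L^p(w)\to L^{p,\infty}(w)}\le c\,[w]_{A_p}^{\frac1p+\frac{k-1}{p-1}}\qquad\text{for all } w\in A_p, \] and if $\beta>0$, $c>0$ are such that $\|M^k\|_{L^p(w)\to L^{p,\infty}(w)}\le c[w]_{A_p}^{\beta}$ for all $w\in A_p$, then $\beta\ge\frac{k-1}{p-1}$.
   Context: $M$ is the Hardy–Littlewood maximal operator on $\mathbb{R}^n$, $Mf(x)=\sup_{Q\ni x}\frac1{|Q|}\int_Q|f|$ over cubes with sides parallel to the axes, and $M^k$ is its $k$-fold iterate. For $1<p<\infty$, $[w]_{A_p}=\sup_Q\big(\frac{1}{|Q|}\int_Q w\big)\big(\frac{1}{|Q|}\int_Q w^{-\frac{1}{p-1}}\big)^{p-1}$; $L^{p,\infty}(w)$ has quasi-norm $\sup_{\lambda>0}\lambda\,w(\{|g|>\lambda\})^{1/p}$. *)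

theory Defs
  imports "HOL-Analysis.Analysis"
begin

definition is_cube :: "'a::euclidean_space set \<Rightarrow> bool" where
  "is_cube Q \<longleftrightarrow> (\<exists>x r. 0 < r \<and> Q = cbox x (x + r *\<^sub>R One))"

definition maximal :: "('a::euclidean_space \<Rightarrow> ennreal) \<Rightarrow> 'a \<Rightarrow> ennreal" where
  "maximal f x = (SUP Q \<in> {Q. is_cube Q \<and> x \<in> Q}.
      (\<integral>\<^sup>+ y. f y * indicator Q y \<partial>lebesgue) / emeasure lebesgue Q)"

definition maximal_iter :: "nat \<Rightarrow> ('a::euclidean_space \<Rightarrow> real) \<Rightarrow> 'a \<Rightarrow> ennreal" where
  "maximal_iter k f = (maximal ^^ k) (\<lambda>y. ennreal \<bar>f y\<bar>)"

text \<open>Real power on ennreal (for positive exponents), with \<infinity> powr a = \<infinity>.\<close>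
definition enn_powr :: "ennreal \<Rightarrow> real \<Rightarrow> ennreal" where
  "enn_powr x a = (if x = \<infinity> then \<infinity> else ennreal (enn2real x powr a))"

definition avg :: "'a::euclidean_space set \<Rightarrow> ('a \<Rightarrow> real) \<Rightarrow> real" where
  "avg Q g = set_lebesgue_integral lebesgue Q g / measure lebesgue Q"

definition Ap_weight :: "real \<Rightarrow> ('a::euclidean_space \<Rightarrow> real) \<Rightarrow> bool" where
  "Ap_weight p w \<longleftrightarrow> w \<in> borel_measurable lebesgue \<and> (AE x in lebesgue. 0 < w x) \<and>
     (\<forall>Q. is_cube Q \<longrightarrow> set_integrable lebesgue Q w \<and>
                         set_integrable lebesgue Q (\<lambda>x. w x powr (- 1 / (p - 1)))) \<and>
     bdd_above {avg Q w * (avg Q (\<lambda>x. w x powr (- 1 / (p - 1)))) powr (p - 1) | Q. is_cube Q}"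

definition Ap_const :: "real \<Rightarrow> ('a::euclidean_space \<Rightarrow> real) \<Rightarrow> real" where
  "Ap_const p w = Sup {avg Q w * (avg Q (\<lambda>x. w x powr (- 1 / (p - 1)))) powr (p - 1) | Q. is_cube Q}"

definition wmeasure :: "('a::euclidean_space \<Rightarrow> real) \<Rightarrow> 'a set \<Rightarrow> ennreal" where
  "wmeasure w A = (\<integral>\<^sup>+ x. ennreal (w x) * indicator A x \<partial>lebesgue)"

definition Lp_norm :: "real \<Rightarrow> ('a::euclidean_space \<Rightarrow> real) \<Rightarrow> ('a \<Rightarrow> real) \<Rightarrow> ennreal" where
  "Lp_norm p w f = enn_powr (\<integral>\<^sup>+ x. ennreal (\<bar>f x\<bar> powr p * w x) \<partial>lebesgue) (1 / p)"

definition weak_norm :: "real \<Rightarrow> ('a::euclidean_space \<Rightarrow> real) \<Rightarrow> ('a \<Rightarrow> ennreal) \<Rightarrow> ennreal" where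
  "weak_norm p w g = (SUP t \<in> {0<..}. ennreal t * enn_powr (wmeasure w {x. ennreal t < g x}) (1 / p))"

definition Mk_norm :: "real \<Rightarrow> nat \<Rightarrow> ('a::euclidean_space \<Rightarrow> real) \<Rightarrow> ennreal" where
  "Mk_norm p k w = (SUP f \<in> {f. f \<in> borel_measurable lebesgue \<and> 0 < Lp_norm p w f \<and> Lp_norm p w f < \<infinity>}.
       weak_norm p w (maximal_iter k f) / Lp_norm p w f)"

end

theory Submission
  imports Defs
begin

text \<open>
  Upper bound. By the one-third trick, \<open>M\<close> restricted to cubes of bounded side is dominated by
  finitely many maximal operators over shifted dyadic grids. For one grid, Lerner's argument with
  \<open>\<sigma> = w powr (- 1 / (p - 1))\<close> gives pointwise
  \<open>(M f) ^ (p - 1) \<le> [w] * M_w ((M_\<sigma> (f / \<sigma>)) ^ (p - 1) / w)\<close>, where the dyadic operators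
  \<open>M_w\<close> and \<open>M_\<sigma>\<close> with respect to \<open>w dx\<close> and \<open>\<sigma> dx\<close> have norms independent of \<open>w\<close>. This
  yields Buckley's strong bound \<open>[w] powr (1 / (p - 1))\<close>. Summing
  \<open>t powr p * w Q \<le> [w] * (integral over Q of (M_\<sigma> (f / \<sigma>)) ^ p d\<sigma>)\<close> over the maximal dyadic cubes
  \<open>Q\<close> of a level set yields the weak bound \<open>[w] powr (1 / p)\<close>. The last of the \<open>k\<close> iterations uses
  the weak bound, the others the strong one.

  Lower bound. In a coordinate direction \<open>e\<close> take \<open>w x = |x \<bullet> e| powr ((p - 1) * (1 - d))\<close>, with
  \<open>[w] \<le> (4 / d) powr (p - 1)\<close>, and \<open>f x = |x \<bullet> e| powr (d - 1)\<close> on the unit cube. Then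
  \<open>M f \<ge> f / d\<close> there, so \<open>M ^ k f \<ge> f / d ^ k\<close>, and \<open>d \<rightarrow> 0\<close> forces
  \<open>(p - 1) * \<beta> \<ge> k - 1 / p\<close>, which is more than claimed.
\<close>

section \<open>Real powers of extended nonnegative reals\<close>

text \<open>Nestedness of cells replaces doubling: the coarsest cells above a level are disjoint, so
  a dyadic maximal operator is of weak type (1,1) with constant 1 for every measure. Doubling
  constants of \<open>w dx\<close> and \<open>\<sigma> dx\<close>, which would depend on
  \<open>w\<close>, never enter. All dependence on \<open>w\<close> comes from
  \<open>W * S powr (p - 1) \<le> A * m powr p\<close> on a cell of Lebesgue measure
  \<open>m\<close>, \<open>w\<close>-measure \<open>W\<close> and \<open>\<sigma>\<close>-measure
  \<open>S\<close>, applied after writing an average of \<open>f\<close> as the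
  \<open>\<sigma>\<close>-average of \<open>f / \<sigma>\<close> times \<open>S / m\<close>. Both
  bounds are proved for integrals of \<open>p\<close>-th powers. There the strong one costs
  \<open>A powr (p / (p - 1))\<close>, since the pointwise inequality is raised to the conjugate
  exponent, while the weak one costs only \<open>A\<close>; \<open>p\<close>-th roots give the
  stated exponents. Side lengths have to be bounded first because the generations of a grid are
  indexed by \<open>nat\<close> from coarse to fine: this gives every point a coarsest admissible
  cell, but no cell exceeds the top size. The constants do not depend on that size, so it can tend
  to infinity at the end.\<close>

lemma enn_powr_0 [simp]: "enn_powr 0 a = 0"
  by (simp add: enn_powr_def)

lemma enn_powr_top [simp]: "enn_powr top a = top"
  by (simp add: enn_powr_def)

lemma enn_powr_ennreal: "0 \<le> x \<Longrightarrow> enn_powr (ennreal x) a = ennreal (x powr a)"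
  by (simp add: enn_powr_def)

lemma enn_powr_mono: "x \<le> y \<Longrightarrow> 0 \<le> a \<Longrightarrow> enn_powr x a \<le> enn_powr y a"
  by (cases x; cases y) (auto simp: enn_powr_ennreal top_unique intro!: powr_mono2 ennreal_leI)

text \<open>Valid for every real exponent, since the conventions \<open>0 powr a = 0\<close> and
  \<open>enn_powr top a = top\<close> are compatible with \<open>0 * top = 0\<close>.\<close>

lemma enn_powr_mult: "enn_powr (x * y) a = enn_powr x a * enn_powr y a"
proof (cases x; cases y)
  fix r s assume "x = ennreal r" "0 \<le> r" "y = ennreal s" "0 \<le> s"
  then show ?thesis
    by (simp add: enn_powr_ennreal powr_mult flip: ennreal_mult)
qed (auto simp: enn_powr_ennreal ennreal_mult_eq_top_iff ennreal_mult_top ennreal_top_mult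
     enn_powr_def)

lemma enn_powr_powr: "enn_powr (enn_powr x a) b = enn_powr x (a * b)"
  by (cases x) (auto simp: enn_powr_ennreal powr_powr)

lemma enn_powr_add: "enn_powr x a * enn_powr x b = enn_powr x (a + b)"
  by (cases x) (auto simp: enn_powr_ennreal powr_add ennreal_mult)

lemma enn_powr_one [simp]: "enn_powr x 1 = x"
  by (cases x) (auto simp: enn_powr_ennreal)

text \<open>A positive power is an order isomorphism with inverse the power \<open>1 / a\<close>.
  This lets powers pass through suprema.\<close>

lemma enn_powr_le_iff: "0 < a \<Longrightarrow> enn_powr x a \<le> y \<longleftrightarrow> x \<le> enn_powr y (1 / a)"
  using enn_powr_mono[of "enn_powr x a" y "1 / a"] enn_powr_mono[of x "enn_powr y (1 / a)" a]
  by (auto simp: enn_powr_powr)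

lemma enn_powr_SUP: "0 < a \<Longrightarrow> enn_powr (SUP i\<in>I. f i) a = (SUP i\<in>I. enn_powr (f i) a)"
proof (rule antisym)
  assume a: "0 < a"
  show "enn_powr (SUP i\<in>I. f i) a \<le> (SUP i\<in>I. enn_powr (f i) a)"
    unfolding enn_powr_le_iff[OF a]
    by (rule SUP_least) (auto simp: enn_powr_le_iff[OF a, symmetric] intro: SUP_upper)
  show "(SUP i\<in>I. enn_powr (f i) a) \<le> enn_powr (SUP i\<in>I. f i) a"
    using a by (intro SUP_least enn_powr_mono SUP_upper) auto
qed

lemma borel_measurable_enn_powr [measurable (raw)]:
  "f \<in> borel_measurable M \<Longrightarrow> (\<lambda>x. enn_powr (f x) a) \<in> borel_measurable M"
  unfolding enn_powr_def by (intro measurable_If) (measurable, auto)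

text \<open>Countable additivity turns an estimate on each cell of a stopping family into one on the
  whole level set.\<close>

lemma emeasure_Union_disjoint_mono:
  assumes P: "countable P" "disjoint P" "P \<subseteq> sets M"
    and sets: "sets \<mu> = sets M" "sets \<nu> = sets M"
    and le: "\<And>Q. Q \<in> P \<Longrightarrow> emeasure \<mu> Q \<le> emeasure \<nu> Q"
  shows "emeasure \<mu> (\<Union>P) \<le> emeasure \<nu> (\<Union>P)"
proof -
  have d: "disjoint_family_on (\<lambda>Q. Q) P"
    using P(2) by (auto simp: disjoint_family_on_def disjoint_def)
  have "emeasure N (\<Union>P) = (\<integral>\<^sup>+Q. emeasure N Q \<partial>count_space P)" if "sets N = sets M" for N
    using emeasure_UN_countable[of P "\<lambda>Q. Q" N] P d that by auto
  then show ?thesis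
    using sets le by (auto intro!: nn_integral_mono)
qed

text \<open>The inner integral of the layer-cake formula, for heights \<open>y\<close> that may be
  infinite.\<close>

lemma nn_integral_powr_below:
  assumes s: "0 < s"
  shows "(\<integral>\<^sup>+t. ennreal (t powr (s - 1)) * indicator {t. 0 < t \<and> ennreal t < y} t \<partial>lborel)
      = enn_powr y s / ennreal s"
proof -
  have fin: "(\<integral>\<^sup>+t. ennreal (t powr (s - 1)) * indicator {t. 0 < t \<and> ennreal t < ennreal r} t \<partial>lborel)
      = ennreal (r powr s / s)" if r: "0 \<le> r" for r
  proof -
    have "(\<integral>\<^sup>+t. ennreal (t powr (s - 1)) * indicator {0..r} t \<partial>lborel) = ennreal (r powr s / s)"
      using nn_integral_has_integral_lebesgue'[OF _ has_integral_powr_from_0[of "s - 1" r]] s r by simp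
    \<comment> \<open>The open and the closed range of \<open>t\<close> differ only in the
      endpoints, and at \<open>0\<close> the integrand vanishes.\<close>
    moreover have "AE t in lborel. t \<noteq> r"
      by (rule AE_lborel_singleton)
    then have "(\<integral>\<^sup>+t. ennreal (t powr (s - 1)) * indicator {0..r} t \<partial>lborel) =
       (\<integral>\<^sup>+t. ennreal (t powr (s - 1)) * indicator {t. 0 < t \<and> ennreal t < ennreal r} t \<partial>lborel)"
      using r by (intro nn_integral_cong_AE)
        (auto simp: indicator_def ennreal_less_iff elim!: eventually_mono)
    ultimately show ?thesis by simp
  qed
  show ?thesis
  proof (cases y)
    case (real r)
    then show ?thesis using fin[of r] s by (simp add: enn_powr_ennreal divide_ennreal)
  next
    case top
    have "(\<integral>\<^sup>+t. ennreal (t powr (s - 1)) * indicator {t. 0 < t \<and> ennreal t < top} t \<partial>lborel) \<ge> ennreal z"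
      (is "?I \<ge> _") for z
    proof -
      \<comment> \<open>Solves \<open>r powr s / s = max z 0\<close>, so the integral cut off at
        \<open>r\<close> already reaches \<open>z\<close>.\<close>
      define r where "r = (s * max z 0) powr (1 / s)"
      have "ennreal (r powr s / s) \<le> ?I"
        unfolding r_def by (subst fin[symmetric]) (auto intro!: nn_integral_mono simp: indicator_def)
      moreover have "r powr s / s = max z 0"
        using s by (simp add: r_def powr_powr)
      ultimately show ?thesis
        by (metis ennreal_leI max.cobounded1 order.trans)
    qed
    then have "?I = top"
      by (cases ?I) (metis ennreal_less_iff leD less_add_one, simp)
    then show ?thesis using top s by (simp add: ennreal_top_divide)
  qed
qed

text \<open>Degenerate denominators are included: for \<open>y = 0\<close> the product is
  \<open>0\<close>, and for \<open>y = top\<close> the quotient is \<open>0\<close>. Cells of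
  measure zero or infinity thus need no separate treatment.\<close>

lemma ennreal_less_divide_imp: "t < x / y \<Longrightarrow> t * y \<le> (x::ennreal)"
  by (cases x; cases y; cases t; cases "y = 0")
    (auto simp: ennreal_less_iff divide_ennreal ennreal_top_divide field_simps ennreal_mult_top
       simp flip: ennreal_mult intro!: ennreal_leI)

section \<open>Maximal operators of nested partitions\<close>

definition cell_max :: "(nat \<Rightarrow> 'a \<Rightarrow> 'a set) \<Rightarrow> 'a measure \<Rightarrow> ('a \<Rightarrow> ennreal) \<Rightarrow> 'a \<Rightarrow> ennreal" where
  "cell_max cell N g x = (SUP i. (\<integral>\<^sup>+y\<in>cell i x. g y \<partial>N) / emeasure N (cell i x))"

text \<open>\<open>cell i\<close> is a countable measurable partition, refined as \<open>i\<close>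
  grows; generation \<open>0\<close> is the coarsest. Having a coarsest generation is what makes
  stopping times exist as a least index.\<close>

locale cell_filtration =
  fixes M :: "'a measure" and cell :: "nat \<Rightarrow> 'a \<Rightarrow> 'a set"
  assumes space_UNIV: "space M = UNIV"
    and sets_cell: "cell i x \<in> sets M"
    and countable_cells: "countable (range (cell i))"
    and in_cell: "x \<in> cell i x"
    and cell_eq: "y \<in> cell i x \<Longrightarrow> cell i y = cell i x"
    and cell_decseq: "i \<le> j \<Longrightarrow> cell j x \<subseteq> cell i x"
begin

text \<open>A stopping-time argument: every point is assigned the coarsest of its cells that satisfies
  the predicate.\<close>
lemma stopping_cells:
  fixes Pr :: "'a set \<Rightarrow> bool"
  obtains P where "countable P" "disjoint P" "P \<subseteq> (\<Union>i. range (cell i))" "\<And>Q. Q \<in> P \<Longrightarrow> Pr Q"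
    "\<Union>P = {x. \<exists>i. Pr (cell i x)}"
proof -
  define E where "E = {x. \<exists>i. Pr (cell i x)}"
  define k where "k x = (LEAST i. Pr (cell i x))" for x
  have k: "Pr (cell (k x) x)" if "x \<in> E" for x
    using that unfolding E_def k_def by (auto intro: LeastI)
  have k_le: "k x \<le> i" if "Pr (cell i x)" for x i
    using that unfolding k_def by (rule Least_le)
  define P where "P = (\<lambda>x. cell (k x) x) ` E"
  \<comment> \<open>If two stopped cells meet, then at the coarser index they lie in one cell. It
    satisfies the predicate, so the other point cannot have stopped later.\<close>
  have same: "cell (k x) x = cell (k y) y"
    if "x \<in> E" "y \<in> E" "z \<in> cell (k x) x" "z \<in> cell (k y) y" "k x \<le> k y" for x y z
  proof -
    have "z \<in> cell (k x) y"
      using that cell_decseq by blast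
    then have eq: "cell (k x) y = cell (k x) x"
      using that cell_eq by metis
    then have "k y \<le> k x"
      using k[OF \<open>x \<in> E\<close>] k_le by metis
    with that eq show ?thesis by (metis le_antisym)
  qed
  have "disjoint P"
  proof (rule disjointI)
    fix Q R assume QR: "Q \<in> P" "R \<in> P" "Q \<noteq> R"
    then obtain x y where xy: "x \<in> E" "Q = cell (k x) x" "y \<in> E" "R = cell (k y) y"
      unfolding P_def by blast
    show "Q \<inter> R = {}"
    proof (rule ccontr)
      assume "Q \<inter> R \<noteq> {}"
      then obtain z where "z \<in> cell (k x) x" "z \<in> cell (k y) y"
        using xy by blast
      then show False
        using same[of x y z] same[of y x z] xy QR(3) by (cases "k x \<le> k y") auto
    qed
  qed
  moreover have P: "P \<subseteq> (\<Union>i. range (cell i))"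
    unfolding P_def by auto
  moreover have "countable P"
    using P by (rule countable_subset) (auto intro: countable_cells)
  moreover have "\<Union>P = E"
  proof (intro equalityI subsetI)
    fix y assume "y \<in> \<Union>P"
    then obtain x where x: "x \<in> E" "y \<in> cell (k x) x"
      unfolding P_def by blast
    then have "Pr (cell (k x) y)"
      using k cell_eq by metis
    then show "y \<in> E"
      unfolding E_def by blast
  next
    fix x assume "x \<in> E"
    then show "x \<in> \<Union>P"
      unfolding P_def using in_cell by blast
  qed
  moreover have "\<And>Q. Q \<in> P \<Longrightarrow> Pr Q"
    unfolding P_def using k by blast
  ultimately show ?thesis
    using that[of P] unfolding E_def by blast
qed

text \<open>Holds for arbitrary \<open>Pr\<close>, because the set is a countable union of
  cells.\<close>

lemma sets_ex_cell: "{x. \<exists>i. Pr (cell i x)} \<in> sets M"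
proof -
  obtain P where "countable P" "P \<subseteq> (\<Union>i. range (cell i))" "\<Union>P = {x. \<exists>i. Pr (cell i x)}"
    by (rule stopping_cells[of Pr])
  moreover have "(\<Union>i. range (cell i)) \<subseteq> sets M"
    using sets_cell by auto
  ultimately show ?thesis
    by (metis order.trans sets.countable_Union)
qed

lemma cell_max_greater: "{x. t < cell_max cell N g x} =
    {x. \<exists>i. t < (\<integral>\<^sup>+y\<in>cell i x. g y \<partial>N) / emeasure N (cell i x)}"
  by (auto simp: cell_max_def less_SUP_iff)

lemma borel_measurable_cell_max [measurable]: "cell_max cell N g \<in> borel_measurable M"
  using sets_ex_cell[of "\<lambda>Q. _ < (\<integral>\<^sup>+y\<in>Q. g y \<partial>N) / emeasure N Q"] space_UNIV
  by (intro borel_measurableI_greater) (auto simp: cell_max_greater)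

text \<open>Each stopped cell \<open>Q\<close> satisfies
  \<open>t * N Q \<le> (integral of g over Q)\<close>, and the stopped cells are disjoint. Summing
  gives constant 1 for any measure \<open>N\<close> on the same sets.\<close>

lemma cell_max_weak:
  assumes N: "sets N = sets M" and [measurable]: "g \<in> borel_measurable N"
  shows "t * emeasure N {x. t < cell_max cell N g x} \<le> (\<integral>\<^sup>+x. g x \<partial>N)"
proof -
  obtain P where P: "countable P" "disjoint P" "P \<subseteq> (\<Union>i. range (cell i))"
    "\<And>Q. Q \<in> P \<Longrightarrow> t < (\<integral>\<^sup>+y\<in>Q. g y \<partial>N) / emeasure N Q"
    "\<Union>P = {x. t < cell_max cell N g x}"
    unfolding cell_max_greater
    by (rule stopping_cells[of "\<lambda>Q. t < (\<integral>\<^sup>+y\<in>Q. g y \<partial>N) / emeasure N Q"]) blast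
  have PM: "P \<subseteq> sets M" "\<And>Q. Q \<in> P \<Longrightarrow> Q \<in> sets N" using P(3) sets_cell N by auto
  have E: "\<Union>P \<in> sets N"
    using P(1) PM(2) by auto
  have "t * emeasure N (\<Union>P) = emeasure (density N (\<lambda>_. t)) (\<Union>P)"
    using E by (simp add: emeasure_density nn_integral_cmult)
  also have "\<dots> \<le> emeasure (density N g) (\<Union>P)"
  proof (rule emeasure_Union_disjoint_mono[OF P(1,2) PM(1)])
    fix Q assume "Q \<in> P"
    then show "emeasure (density N (\<lambda>_. t)) Q \<le> emeasure (density N g) Q"
      using ennreal_less_divide_imp[OF P(4)[of Q]] PM(2)
      by (simp add: emeasure_density nn_integral_cmult)
  qed (use N in auto)
  also have "\<dots> \<le> (\<integral>\<^sup>+x. g x \<partial>N)"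
    using E by (auto simp: emeasure_density indicator_def intro!: nn_integral_mono)
  finally show ?thesis using P(5) by simp
qed

text \<open>Splitting \<open>g\<close> at height \<open>t / 2\<close> puts the truncated function into the weak-type bound.\<close>
lemma cell_max_weak_truncated:
  assumes N: "sets N = sets M" and [measurable]: "g \<in> borel_measurable N" and t: "0 < t"
  shows "emeasure N {x. ennreal t < cell_max cell N g x} \<le>
    ennreal (2 / t) * (\<integral>\<^sup>+x. g x * indicator {x. ennreal t < 2 * g x} x \<partial>N)"
proof -
  let ?g = "\<lambda>x. g x * indicator {x. ennreal t < 2 * g x} x"
  have sp: "space N = UNIV" using N space_UNIV sets_eq_imp_space_eq by metis
  have [measurable]: "?g \<in> borel_measurable N" using sp by measurable
  have g_le: "g y \<le> ?g y + ennreal (t / 2)" for y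
    using t by (cases "g y") (auto simp: indicator_def ennreal_less_iff not_less
      simp flip: ennreal_mult'' ennreal_numeral intro!: ennreal_leI)
  have "cell_max cell N g x \<le> cell_max cell N ?g x + ennreal (t / 2)" for x
    unfolding cell_max_def
  proof (rule SUP_least)
    fix i
    have [measurable]: "cell i x \<in> sets N" using N sets_cell by simp
    have "(\<integral>\<^sup>+y\<in>cell i x. g y \<partial>N) \<le> (\<integral>\<^sup>+y. ?g y * indicator (cell i x) y + ennreal (t / 2) * indicator (cell i x) y \<partial>N)"
      using g_le by (intro nn_integral_mono) (auto simp: indicator_def split: if_splits)
    also have "\<dots> = (\<integral>\<^sup>+y\<in>cell i x. ?g y \<partial>N) + ennreal (t / 2) * emeasure N (cell i x)"
      by (subst nn_integral_add) (auto simp: nn_integral_cmult)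
    finally have "(\<integral>\<^sup>+y\<in>cell i x. g y \<partial>N) / emeasure N (cell i x) \<le>
       (\<integral>\<^sup>+y\<in>cell i x. ?g y \<partial>N) / emeasure N (cell i x) + ennreal (t / 2) * emeasure N (cell i x) / emeasure N (cell i x)"
      by (metis add_divide_distrib_ennreal divide_right_mono_ennreal)
    \<comment> \<open>Only an inequality: when the measure of the cell is zero or infinite, the left
      side is \<open>0\<close>.\<close>
    also have "ennreal (t / 2) * emeasure N (cell i x) / emeasure N (cell i x) \<le> ennreal (t / 2)"
      by (cases "emeasure N (cell i x) = 0"; cases "emeasure N (cell i x) = top")
        (auto simp: mult_divide_eq_ennreal)
    also have "(\<integral>\<^sup>+y\<in>cell i x. ?g y \<partial>N) / emeasure N (cell i x) \<le>
        (SUP i. (\<integral>\<^sup>+y\<in>cell i x. ?g y \<partial>N) / emeasure N (cell i x))"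
      by (rule SUP_upper) simp
    finally show "(\<integral>\<^sup>+y\<in>cell i x. g y \<partial>N) / emeasure N (cell i x) \<le>
       (SUP i. (\<integral>\<^sup>+y\<in>cell i x. ?g y \<partial>N) / emeasure N (cell i x)) + ennreal (t / 2)"
      by (simp add: add_mono)
  qed
  then have "{x. ennreal t < cell_max cell N g x} \<subseteq> {x. ennreal (t / 2) < cell_max cell N ?g x}"
  proof (intro subsetI CollectI, goal_cases)
    case (1 x)
    have "ennreal (t / 2) + ennreal (t / 2) = ennreal t"
      using t by (simp flip: ennreal_plus)
    then have "ennreal (t / 2) + ennreal (t / 2) < cell_max cell N ?g x + ennreal (t / 2)"
      using 1(1)[of x] 1(2) by (auto intro: order.strict_trans2)
    then show ?case
      by (auto simp: not_le[symmetric] intro: add_right_mono)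
  qed
  moreover have meas: "{x. s < cell_max cell N h x} \<in> sets N" for s h
    using sets_ex_cell N by (simp add: cell_max_greater)
  ultimately have "emeasure N {x. ennreal t < cell_max cell N g x} \<le> emeasure N {x. ennreal (t / 2) < cell_max cell N ?g x}"
    by (intro emeasure_mono) auto
  also have "\<dots> = ennreal (2 / t) * (ennreal (t / 2) * emeasure N {x. ennreal (t / 2) < cell_max cell N ?g x})"
    using t by (simp add: mult.assoc[symmetric] ennreal_mult[symmetric])
  also have "\<dots> \<le> ennreal (2 / t) * (\<integral>\<^sup>+x. ?g x \<partial>N)"
    by (intro mult_left_mono cell_max_weak[OF N]) auto
  finally show ?thesis .
qed

text \<open>Marcinkiewicz interpolation. Layer cake and the truncated weak bound give
  \<open>p\<close> times the integral of \<open>t powr (p - 1) * (2 / t) * g\<close> over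
  \<open>t < 2 * g\<close>. After Fubini this is \<open>p / (p - 1) * (2 * g) powr p\<close>, the
  source of the constant. Sigma-finiteness serves Fubini.\<close>

lemma cell_max_strong:
  assumes N: "sets N = sets M" "sigma_finite_measure N" and [measurable]: "g \<in> borel_measurable N"
    and p: "1 < p"
  shows "(\<integral>\<^sup>+x. enn_powr (cell_max cell N g x) p \<partial>N) \<le>
    ennreal (2 powr p * p / (p - 1)) * (\<integral>\<^sup>+x. enn_powr (g x) p \<partial>N)"
proof -
  interpret sigma_finite_measure N by fact
  interpret pair_sigma_finite N "lborel :: real measure" ..
  let ?m = "cell_max cell N g"
  have [measurable]: "?m \<in> borel_measurable N"
    using borel_measurable_cell_max measurable_cong_sets[OF N(1) refl] by blast
  have sp: "space N = UNIV" using N space_UNIV sets_eq_imp_space_eq by metis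
  have layer: "enn_powr y s = ennreal s * (\<integral>\<^sup>+t. ennreal (t powr (s - 1)) * indicator {t. 0 < t \<and> ennreal t < y} t \<partial>lborel)"
    if "0 < s" for y s
    unfolding nn_integral_powr_below[OF that] ennreal_times_divide using that
    by (subst mult.commute, subst mult_divide_eq_ennreal) auto
  have ind: "ennreal (t powr (s - 1)) * indicator {t. 0 < t \<and> ennreal t < y} t =
    (if 0 < t \<and> ennreal t < y then ennreal (t powr (s - 1)) else 0)" for t s y by auto
  have "(\<integral>\<^sup>+x. enn_powr (?m x) p \<partial>N) =
    (\<integral>\<^sup>+x. ennreal p * (\<integral>\<^sup>+t. (if 0 < t \<and> ennreal t < ?m x then ennreal (t powr (p - 1)) else 0) \<partial>lborel) \<partial>N)"
    using p by (subst layer) (auto simp: ind)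
  also have "\<dots> = ennreal p * (\<integral>\<^sup>+x. (\<integral>\<^sup>+t. (if 0 < t \<and> ennreal t < ?m x then ennreal (t powr (p - 1)) else 0) \<partial>lborel) \<partial>N)"
    by (rule nn_integral_cmult) measurable
  also have "(\<integral>\<^sup>+x. (\<integral>\<^sup>+t. (if 0 < t \<and> ennreal t < ?m x then ennreal (t powr (p - 1)) else 0) \<partial>lborel) \<partial>N)
    = (\<integral>\<^sup>+t. (\<integral>\<^sup>+x. (if 0 < t \<and> ennreal t < ?m x then ennreal (t powr (p - 1)) else 0) \<partial>N) \<partial>lborel)"
    by (rule Fubini'[symmetric]) measurable
  also have "\<dots> \<le> (\<integral>\<^sup>+t. (\<integral>\<^sup>+x. (if 0 < t \<and> ennreal t < 2 * g x then ennreal 2 * g x * ennreal (t powr (p - 1 - 1)) else 0) \<partial>N) \<partial>lborel)"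
  proof (rule nn_integral_mono)
    fix t :: real
    show "(\<integral>\<^sup>+x. (if 0 < t \<and> ennreal t < ?m x then ennreal (t powr (p - 1)) else 0) \<partial>N) \<le>
      (\<integral>\<^sup>+x. (if 0 < t \<and> ennreal t < 2 * g x then ennreal 2 * g x * ennreal (t powr (p - 1 - 1)) else 0) \<partial>N)"
    proof (cases "0 < t")
      case True
      have [measurable]: "{x. ennreal t < ?m x} \<in> sets N"
        using sets_ex_cell N by (simp add: cell_max_greater)
      have [measurable]: "(\<lambda>x. g x * indicator {x. ennreal t < 2 * g x} x) \<in> borel_measurable N" using sp by measurable
      have "(\<integral>\<^sup>+x. (if 0 < t \<and> ennreal t < ?m x then ennreal (t powr (p - 1)) else 0) \<partial>N)
         = (\<integral>\<^sup>+x. ennreal (t powr (p - 1)) * indicator {x. ennreal t < ?m x} x \<partial>N)"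
        using True by (intro nn_integral_cong) auto
      also have "\<dots> = ennreal (t powr (p - 1)) * emeasure N {x. ennreal t < ?m x}"
        by (rule nn_integral_cmult_indicator) measurable
      also have "\<dots> \<le> ennreal (t powr (p - 1)) * (ennreal (2 / t) * (\<integral>\<^sup>+x. g x * indicator {x. ennreal t < 2 * g x} x \<partial>N))"
        using True by (intro mult_left_mono cell_max_weak_truncated N) auto
      also have "\<dots> = ennreal (2 * t powr (p - 1 - 1)) * (\<integral>\<^sup>+x. g x * indicator {x. ennreal t < 2 * g x} x \<partial>N)"
        using True by (simp add: mult.assoc[symmetric] ennreal_mult[symmetric] powr_diff mult.commute power2_eq_square)
      also have "\<dots> = (\<integral>\<^sup>+x. ennreal (2 * t powr (p - 1 - 1)) * (g x * indicator {x. ennreal t < 2 * g x} x) \<partial>N)"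
        by (rule nn_integral_cmult[symmetric]) measurable
      also have "\<dots> = (\<integral>\<^sup>+x. (if 0 < t \<and> ennreal t < 2 * g x then ennreal 2 * g x * ennreal (t powr (p - 1 - 1)) else 0) \<partial>N)"
        using True by (intro nn_integral_cong) (auto simp: ennreal_mult mult_ac)
      finally show ?thesis .
    qed simp
  qed
  also have "\<dots> = (\<integral>\<^sup>+x. (\<integral>\<^sup>+t. (if 0 < t \<and> ennreal t < 2 * g x then ennreal 2 * g x * ennreal (t powr (p - 1 - 1)) else 0) \<partial>lborel) \<partial>N)"
    by (rule Fubini') measurable
  also have "\<dots> = (\<integral>\<^sup>+x. ennreal (2 powr p / (p - 1)) * enn_powr (g x) p \<partial>N)"
  proof (rule nn_integral_cong)
    fix x
    have "(\<integral>\<^sup>+t. (if 0 < t \<and> ennreal t < 2 * g x then ennreal 2 * g x * ennreal (t powr (p - 1 - 1)) else 0) \<partial>lborel)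
      = (\<integral>\<^sup>+t. (2 * g x) * (ennreal (t powr (p - 1 - 1)) * indicator {t. 0 < t \<and> ennreal t < 2 * g x} t) \<partial>lborel)"
      by (intro nn_integral_cong) auto
    also have "\<dots> = (2 * g x) * (\<integral>\<^sup>+t. ennreal (t powr (p - 1 - 1)) * indicator {t. 0 < t \<and> ennreal t < 2 * g x} t \<partial>lborel)"
      by (rule nn_integral_cmult) measurable
    also have "\<dots> = (enn_powr (2 * g x) 1 * enn_powr (2 * g x) (p - 1)) / ennreal (p - 1)"
      using p by (subst nn_integral_powr_below) (auto simp: ennreal_times_divide)
    also have "\<dots> = enn_powr (2 * g x) p / ennreal (p - 1)"
      by (simp only: enn_powr_add) simp
    also have "\<dots> = ennreal (2 powr p / (p - 1)) * enn_powr (g x) p"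
      using p enn_powr_ennreal[of 2 p]
      by (simp add: enn_powr_mult divide_ennreal[symmetric] ennreal_divide_times[symmetric])
         (simp add: divide_ennreal_def mult_ac)
    finally show "(\<integral>\<^sup>+t. (if 0 < t \<and> ennreal t < 2 * g x then ennreal 2 * g x * ennreal (t powr (p - 1 - 1)) else 0) \<partial>lborel) = \<dots>" .
  qed
  also have "\<dots> = ennreal (2 powr p / (p - 1)) * (\<integral>\<^sup>+x. enn_powr (g x) p \<partial>N)"
    by (rule nn_integral_cmult) measurable
  finally have "(\<integral>\<^sup>+x. enn_powr (?m x) p \<partial>N) \<le> ennreal p * (ennreal (2 powr p / (p - 1)) * (\<integral>\<^sup>+x. enn_powr (g x) p \<partial>N))"
    by (simp add: mult_left_mono)
  also have "\<dots> = ennreal (2 powr p * p / (p - 1)) * (\<integral>\<^sup>+x. enn_powr (g x) p \<partial>N)"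
    using p by (simp add: mult.assoc[symmetric] ennreal_mult[symmetric] mult.commute)
  finally show ?thesis .
qed

end

section \<open>Weighted bounds for nested partitions\<close>

lemma nn_integral_pos:
  assumes [measurable]: "u \<in> borel_measurable M" "Q \<in> sets M" and u: "\<And>x. 0 < (u x :: real)"
    and Q: "0 < emeasure M Q"
  shows "0 < (\<integral>\<^sup>+y\<in>Q. ennreal (u y) \<partial>M)"
proof (rule ccontr)
  assume "\<not> ?thesis"
  then have "(\<integral>\<^sup>+y\<in>Q. ennreal (u y) \<partial>M) = 0" by simp
  then have "AE y in M. ennreal (u y) * indicator Q y = 0"
    by (subst (asm) nn_integral_0_iff_AE) auto
  then have "AE y in M. y \<notin> Q"
    by eventually_elim (use u in \<open>force simp: indicator_def ennreal_eq_0_iff not_le[symmetric] split: if_splits\<close>)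
  then have "Q \<in> null_sets M"
    by (simp add: AE_iff_null_sets)
  then show False using Q by auto
qed

text \<open>\<open>A\<close> is any positive bound for the \<open>A_p\<close> quantity over the
  cells. The condition is written with integrals instead of averages, that is, multiplied by the
  \<open>p\<close>-th power of the measure of the cell. Pointwise positivity makes division by
  \<open>w\<close> and by \<open>\<sigma>\<close> legitimate everywhere.\<close>

locale Ap_cell_filtration = cell_filtration +
  fixes w :: "'a \<Rightarrow> real" and p A :: real
  assumes w_measurable [measurable]: "w \<in> borel_measurable M"
    and w_pos: "0 < w x"
    and p_gt_1: "1 < p"
    and A_pos: "0 < A"
    and sigma_finite_M: "sigma_finite_measure M"
    and emeasure_cell: "0 < emeasure M (cell i x)" "emeasure M (cell i x) < \<infinity>"
    and w_finite: "(\<integral>\<^sup>+y\<in>cell i x. ennreal (w y) \<partial>M) < \<infinity>"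
    and dual_finite: "(\<integral>\<^sup>+y\<in>cell i x. ennreal (w y powr (- 1 / (p - 1))) \<partial>M) < \<infinity>"
    and Ap_le: "(\<integral>\<^sup>+y\<in>cell i x. ennreal (w y) \<partial>M) *
        enn_powr (\<integral>\<^sup>+y\<in>cell i x. ennreal (w y powr (- 1 / (p - 1))) \<partial>M) (p - 1)
      \<le> ennreal A * enn_powr (emeasure M (cell i x)) p"
begin

abbreviation \<sigma> :: "'a \<Rightarrow> real" where "\<sigma> x \<equiv> w x powr (- 1 / (p - 1))"

definition Nw :: "'a measure" where "Nw = density M (\<lambda>x. ennreal (w x))"
definition N\<sigma> :: "'a measure" where "N\<sigma> = density M (\<lambda>x. ennreal (\<sigma> x))"

lemma sets_Nw [measurable_cong, simp]: "sets Nw = sets M" and sets_N\<sigma> [measurable_cong, simp]: "sets N\<sigma> = sets M"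
  by (simp_all add: Nw_def N\<sigma>_def)

lemma sigma_finite_Nw: "sigma_finite_measure Nw" and sigma_finite_N\<sigma>: "sigma_finite_measure N\<sigma>"
  using sigma_finite_measure.sigma_finite_iff_density_finite[OF sigma_finite_M]
  by (auto simp: Nw_def N\<sigma>_def)

text \<open>Positivity and finiteness on cells allow the \<open>A_p\<close> inequality to be
  manipulated with real numbers.\<close>

lemma cell_values:
  obtains m W S where "0 < m" "0 < W" "0 < S"
    "emeasure M (cell i x) = ennreal m"
    "(\<integral>\<^sup>+y\<in>cell i x. ennreal (w y) \<partial>M) = ennreal W" "(\<integral>\<^sup>+y\<in>cell i x. ennreal (\<sigma> y) \<partial>M) = ennreal S"
    "W * S powr (p - 1) \<le> A * m powr p"
proof -
  obtain m where m: "emeasure M (cell i x) = ennreal m" "0 < m"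
    using emeasure_cell[of i x] by (cases "emeasure M (cell i x)") auto
  obtain W where W: "(\<integral>\<^sup>+y\<in>cell i x. ennreal (w y) \<partial>M) = ennreal W" "0 < W"
    using w_finite[of i x] nn_integral_pos[of w M "cell i x"] w_pos sets_cell emeasure_cell(1)[of i x]
    by (cases "(\<integral>\<^sup>+y\<in>cell i x. ennreal (w y) \<partial>M)") auto
  have "0 < \<sigma> x" for x using w_pos[of x] by simp
  then obtain S where S: "(\<integral>\<^sup>+y\<in>cell i x. ennreal (\<sigma> y) \<partial>M) = ennreal S" "0 < S"
    using dual_finite[of i x] nn_integral_pos[of \<sigma> M "cell i x"] sets_cell emeasure_cell(1)[of i x]
    by (cases "(\<integral>\<^sup>+y\<in>cell i x. ennreal (\<sigma> y) \<partial>M)") auto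
  have "ennreal (W * S powr (p - 1)) \<le> ennreal (A * m powr p)"
    using Ap_le[of i x] m W S A_pos by (simp add: enn_powr_ennreal ennreal_mult)
  then have "W * S powr (p - 1) \<le> A * m powr p"
    using A_pos by (simp add: ennreal_le_iff)
  with m W S show ?thesis by (intro that) auto
qed

text \<open>The dyadic form of the operator taking \<open>f\<close> to
  \<open>M_\<sigma> (f / \<sigma>)\<close>: dividing by \<open>\<sigma>\<close> cancels the density,
  so its averages are integrals of \<open>f\<close> over \<open>\<sigma>\<close>-measures of
  cells.\<close>

definition dual_max :: "('a \<Rightarrow> ennreal) \<Rightarrow> 'a \<Rightarrow> ennreal" where
  "dual_max f = cell_max cell N\<sigma> (\<lambda>x. f x * ennreal (1 / \<sigma> x))"

lemma borel_measurable_dual_max [measurable]: "dual_max f \<in> borel_measurable M"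
  unfolding dual_max_def by measurable

text \<open>All points \<open>y\<close> of a cell see the same average, so it stays below
  \<open>dual_max f\<close> throughout the cell and may be moved under an integral over it.\<close>

lemma average_le_dual_max:
  assumes [measurable]: "f \<in> borel_measurable M" and y: "y \<in> cell i x"
  shows "(\<integral>\<^sup>+z\<in>cell i x. f z \<partial>M) / (\<integral>\<^sup>+z\<in>cell i x. ennreal (\<sigma> z) \<partial>M) \<le> dual_max f y"
proof -
  have [measurable]: "cell i x \<in> sets M" by (rule sets_cell)
  have *: "ennreal (\<sigma> z) * (f z * ennreal (1 / \<sigma> z) * indicator Q z) = f z * indicator Q z" for z Q
  proof -
    have "ennreal (\<sigma> z) * ennreal (1 / \<sigma> z) = 1"
      using w_pos[of z] by (simp flip: ennreal_mult)
    then show ?thesis by (metis mult.assoc mult.commute mult.right_neutral)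
  qed
  have "(\<integral>\<^sup>+z\<in>cell i x. f z \<partial>M) = (\<integral>\<^sup>+z\<in>cell i x. (f z * ennreal (1 / \<sigma> z)) \<partial>N\<sigma>)"
    unfolding N\<sigma>_def by (subst nn_integral_density) (simp_all only: *, measurable)
  moreover have "(\<integral>\<^sup>+z\<in>cell i x. ennreal (\<sigma> z) \<partial>M) = emeasure N\<sigma> (cell i x)"
    unfolding N\<sigma>_def by (subst emeasure_density) auto
  ultimately show ?thesis
    unfolding dual_max_def cell_max_def using cell_eq[OF y] by (intro SUP_upper2[of i]) auto
qed

text \<open>Since \<open>\<sigma> powr (1 - p) = w\<close>, the norm of \<open>f / \<sigma>\<close>
  in \<open>L^p(\<sigma>)\<close> is the norm of \<open>f\<close> in \<open>L^p(w)\<close>.\<close>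

lemma dual_max_strong:
  assumes [measurable]: "f \<in> borel_measurable M"
  shows "(\<integral>\<^sup>+x. enn_powr (dual_max f x) p \<partial>N\<sigma>) \<le>
    ennreal (2 powr p * p / (p - 1)) * (\<integral>\<^sup>+x. enn_powr (f x) p * ennreal (w x) \<partial>M)"
proof -
  have "(\<integral>\<^sup>+x. enn_powr (dual_max f x) p \<partial>N\<sigma>) \<le>
    ennreal (2 powr p * p / (p - 1)) * (\<integral>\<^sup>+x. enn_powr (f x * ennreal (1 / \<sigma> x)) p \<partial>N\<sigma>)"
    unfolding dual_max_def using sigma_finite_N\<sigma> p_gt_1 by (intro cell_max_strong) auto
  also have "(\<integral>\<^sup>+x. enn_powr (f x * ennreal (1 / \<sigma> x)) p \<partial>N\<sigma>) =
     (\<integral>\<^sup>+x. ennreal (\<sigma> x) * enn_powr (f x * ennreal (1 / \<sigma> x)) p \<partial>M)"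
    unfolding N\<sigma>_def by (subst nn_integral_density) auto
  also have "\<dots> = (\<integral>\<^sup>+x. enn_powr (f x) p * ennreal (w x) \<partial>M)"
  proof (rule nn_integral_cong)
    fix x
    have "\<sigma> x * (1 / \<sigma> x) powr p = w x"
    proof -
      have "1 / \<sigma> x = w x powr (1 / (p - 1))"
        by (simp add: powr_minus_divide)
      then have "\<sigma> x * (1 / \<sigma> x) powr p = w x powr (- 1 / (p - 1) + (1 / (p - 1)) * p)"
        by (simp only: powr_powr powr_add)
      also have "- 1 / (p - 1) + (1 / (p - 1)) * p = 1"
        using p_gt_1 by (simp add: diff_divide_distrib[symmetric])
      finally show ?thesis using w_pos[of x] by simp
    qed
    then show "ennreal (\<sigma> x) * enn_powr (f x * ennreal (1 / \<sigma> x)) p = enn_powr (f x) p * ennreal (w x)"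
      by (simp add: enn_powr_mult enn_powr_ennreal mult.left_commute flip: ennreal_mult)
  qed
  finally show ?thesis .
qed

lemma cell_average_dual:
  assumes S: "0 < S" and m: "0 < m"
  shows "F / ennreal m = F / ennreal S * ennreal (S / m)"
  using assms by (cases F) (auto simp: divide_ennreal ennreal_top_divide ennreal_top_mult simp flip: ennreal_mult)

text \<open>Lerner's inequality on one cell. With \<open>F\<close> the integral of \<open>f\<close>,
  the \<open>A_p\<close> condition bounds \<open>(F / m) powr (p - 1)\<close> by
  \<open>A / W\<close> times \<open>m * (F / S) powr (p - 1)\<close>. The latter is at most the
  integral of \<open>dual_max f powr (p - 1)\<close> over the cell, and inserting
  \<open>w * (1 / w) = 1\<close> turns the quotient by \<open>W\<close> into an average with respect
  to \<open>w dx\<close>.\<close>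

lemma cell_average_powr_le:
  assumes [measurable]: "f \<in> borel_measurable M"
  shows "enn_powr ((\<integral>\<^sup>+z\<in>cell i x. f z \<partial>M) / emeasure M (cell i x)) (p - 1) \<le>
    ennreal A * cell_max cell Nw (\<lambda>y. enn_powr (dual_max f y) (p - 1) * ennreal (1 / w y)) x"
proof -
  have [measurable]: "cell i x \<in> sets M" by (rule sets_cell)
  obtain m W S where v: "0 < m" "0 < W" "0 < S"
    "emeasure M (cell i x) = ennreal m"
    "(\<integral>\<^sup>+y\<in>cell i x. ennreal (w y) \<partial>M) = ennreal W" "(\<integral>\<^sup>+y\<in>cell i x. ennreal (\<sigma> y) \<partial>M) = ennreal S"
    "W * S powr (p - 1) \<le> A * m powr p"
    by (rule cell_values)
  define F where "F = (\<integral>\<^sup>+z\<in>cell i x. f z \<partial>M)"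
  let ?h = "\<lambda>y. enn_powr (dual_max f y) (p - 1) * ennreal (1 / w y)"
  \<comment> \<open>The \<open>A_p\<close> inequality divided by
    \<open>W * m powr (p - 1)\<close>.\<close>
  have r: "(S / m) powr (p - 1) \<le> A * m / W"
    using v by (simp add: powr_divide field_simps powr_diff)
  have *: "ennreal (w z) * (a * ennreal (1 / w z) * indicator Q z) = a * indicator Q z" for z Q a
  proof -
    have "ennreal (w z) * ennreal (1 / w z) = 1"
      using w_pos[of z] by (simp flip: ennreal_mult)
    then show ?thesis by (metis mult.assoc mult.commute mult.right_neutral)
  qed
  have "enn_powr (F / ennreal S) (p - 1) * ennreal m = (\<integral>\<^sup>+z\<in>cell i x. enn_powr (F / ennreal S) (p - 1) \<partial>M)"
    using v by (simp add: nn_integral_cmult)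
  also have "\<dots> \<le> (\<integral>\<^sup>+z\<in>cell i x. enn_powr (dual_max f z) (p - 1) \<partial>M)"
  proof (rule nn_integral_mono)
    fix z
    show "enn_powr (F / ennreal S) (p - 1) * indicator (cell i x) z \<le> enn_powr (dual_max f z) (p - 1) * indicator (cell i x) z"
      using average_le_dual_max[of f z i x] v p_gt_1 
      by (auto simp: indicator_def F_def intro!: enn_powr_mono)
  qed
  also have "\<dots> = (\<integral>\<^sup>+z\<in>cell i x. ?h z \<partial>Nw)"
    unfolding Nw_def by (subst nn_integral_density) (auto simp: *)
  finally have h: "enn_powr (F / ennreal S) (p - 1) * ennreal m \<le> (\<integral>\<^sup>+z\<in>cell i x. ?h z \<partial>Nw)" .
  have "enn_powr (F / ennreal m) (p - 1) = enn_powr (F / ennreal S) (p - 1) * ennreal ((S / m) powr (p - 1))"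
    using v by (simp add: cell_average_dual[of S m] enn_powr_mult enn_powr_ennreal)
  also have "\<dots> \<le> enn_powr (F / ennreal S) (p - 1) * ennreal (A * m / W)"
    using r by (intro mult_left_mono ennreal_leI) auto
  also have "\<dots> = ennreal A * ((enn_powr (F / ennreal S) (p - 1) * ennreal m) / ennreal W)"
    using v A_pos by (simp add: divide_ennreal[symmetric] ennreal_mult mult_ac divide_ennreal_def)
  also have "\<dots> \<le> ennreal A * ((\<integral>\<^sup>+z\<in>cell i x. ?h z \<partial>Nw) / ennreal W)"
    by (intro mult_left_mono divide_right_mono_ennreal h) auto
  also have "ennreal W = emeasure Nw (cell i x)"
    unfolding Nw_def using v by (subst emeasure_density) auto
  also have "(\<integral>\<^sup>+z\<in>cell i x. ?h z \<partial>Nw) / emeasure Nw (cell i x) \<le> cell_max cell Nw ?h x"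
    unfolding cell_max_def by (rule SUP_upper) simp
  finally show ?thesis
    using v(4) by (simp add: F_def mult_left_mono)
qed

lemma Ap_strong:
  assumes [measurable]: "f \<in> borel_measurable M"
  shows "(\<integral>\<^sup>+x. enn_powr (cell_max cell M f x) p * ennreal (w x) \<partial>M) \<le>
    ennreal (A powr (p / (p - 1)) * (2 powr (p / (p - 1)) * p) * (2 powr p * p / (p - 1))) *
      (\<integral>\<^sup>+x. enn_powr (f x) p * ennreal (w x) \<partial>M)"
proof -
  \<comment> \<open>The conjugate exponent: the pointwise bound concerns the power
    \<open>p - 1\<close>, and \<open>(p - 1) * q = p\<close>.\<close>
  define q where "q = p / (p - 1)"
  have q: "1 < q" "(p - 1) * q = p" "q / (q - 1) = p" using p_gt_1 by (auto simp: q_def field_simps)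
  let ?h = "\<lambda>y. enn_powr (dual_max f y) (p - 1) * ennreal (1 / w y)"
  have pt: "enn_powr (cell_max cell M f x) p \<le> enn_powr (ennreal A * cell_max cell Nw ?h x) q" for x
  proof -
    have "enn_powr (cell_max cell M f x) (p - 1) \<le> ennreal A * cell_max cell Nw ?h x"
      unfolding cell_max_def[of cell M] using p_gt_1 cell_average_powr_le[of f]
      by (subst enn_powr_SUP) (auto intro!: SUP_least)
    then have "enn_powr (enn_powr (cell_max cell M f x) (p - 1)) q \<le> enn_powr (ennreal A * cell_max cell Nw ?h x) q"
      using q by (intro enn_powr_mono) auto
    then show ?thesis using q by (simp add: enn_powr_powr)
  qed
  have "(\<integral>\<^sup>+x. enn_powr (cell_max cell M f x) p * ennreal (w x) \<partial>M) \<le>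
      (\<integral>\<^sup>+x. ennreal (A powr q) * (enn_powr (cell_max cell Nw ?h x) q * ennreal (w x)) \<partial>M)"
    using pt A_pos by (intro nn_integral_mono) (auto simp: enn_powr_mult enn_powr_ennreal mult_right_mono mult.assoc[symmetric])
  also have "\<dots> = ennreal (A powr q) * (\<integral>\<^sup>+x. (enn_powr (cell_max cell Nw ?h x) q * ennreal (w x)) \<partial>M)"
    by (rule nn_integral_cmult) measurable
  also have "(\<integral>\<^sup>+x. (enn_powr (cell_max cell Nw ?h x) q * ennreal (w x)) \<partial>M) = (\<integral>\<^sup>+x. enn_powr (cell_max cell Nw ?h x) q \<partial>Nw)"
    unfolding Nw_def by (subst nn_integral_density) (auto simp: mult.commute)
  also have "\<dots> \<le> ennreal (2 powr q * q / (q - 1)) * (\<integral>\<^sup>+x. enn_powr (?h x) q \<partial>Nw)"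
    using sigma_finite_Nw q by (intro cell_max_strong) auto
  also have "(\<integral>\<^sup>+x. enn_powr (?h x) q \<partial>Nw) = (\<integral>\<^sup>+x. enn_powr (dual_max f x) p \<partial>N\<sigma>)"
  proof -
    \<comment> \<open>The exponent \<open>1 - q\<close> equals \<open>- 1 / (p - 1)\<close>, so the
      \<open>L^q(w)\<close> integral becomes an \<open>L^p(\<sigma>)\<close> integral of
      \<open>dual_max f\<close>.\<close>
    have "w x * (1 / w x) powr q = \<sigma> x" for x
    proof -
      have "w x * (1 / w x) powr q = w x powr 1 * w x powr (- q)"
        using w_pos[of x] by (simp add: powr_minus_divide powr_divide)
      also have "\<dots> = w x powr (1 + - q)" by (simp only: powr_add)
      also have "1 + - q = - 1 / (p - 1)" using p_gt_1 by (simp add: q_def field_simps)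
      finally show ?thesis .
    qed
    then have "ennreal (w x) * ennreal ((1 / w x) powr q) = ennreal (\<sigma> x)" for x
      using w_pos[of x] by (simp flip: ennreal_mult)
    then have "ennreal (w x) * enn_powr (?h x) q = ennreal (\<sigma> x) * enn_powr (dual_max f x) p" for x
      using w_pos[of x] q
      by (simp add: enn_powr_mult enn_powr_powr enn_powr_ennreal less_imp_le)
        (metis mult.commute mult.left_commute)
    then show ?thesis
      unfolding Nw_def N\<sigma>_def by (simp add: nn_integral_density)
  qed
  also have "\<dots> \<le> ennreal (2 powr p * p / (p - 1)) * (\<integral>\<^sup>+x. enn_powr (f x) p * ennreal (w x) \<partial>M)"
    by (rule dual_max_strong) measurable
  finally have "(\<integral>\<^sup>+x. enn_powr (cell_max cell M f x) p * ennreal (w x) \<partial>M) \<le>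
      ennreal (A powr q) * (ennreal (2 powr q * q / (q - 1)) * (ennreal (2 powr p * p / (p - 1)) * (\<integral>\<^sup>+x. enn_powr (f x) p * ennreal (w x) \<partial>M)))"
    by (simp add: mult_left_mono)
  also have "2 powr q * q / (q - 1) = 2 powr q * p"
    by (metis q(3) times_divide_eq_right)
  also have "ennreal (A powr q) * (ennreal (2 powr q * p) * (ennreal (2 powr p * p / (p - 1)) * (\<integral>\<^sup>+x. enn_powr (f x) p * ennreal (w x) \<partial>M)))
     = ennreal (A powr q * (2 powr q * p) * (2 powr p * p / (p - 1))) * (\<integral>\<^sup>+x. enn_powr (f x) p * ennreal (w x) \<partial>M)"
    using p_gt_1 by (simp add: mult.assoc[symmetric] flip: ennreal_mult)
  finally show ?thesis by (simp add: q_def)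
qed

text \<open>On a stopped cell \<open>t powr p * W\<close> is at most
  \<open>(F / S) powr p * (S / m) powr p * W\<close>. The \<open>A_p\<close> condition bounds the
  last two factors by \<open>A * S\<close>, so only the maximal operator for
  \<open>\<sigma> dx\<close> is needed and \<open>A\<close> enters to the first power.\<close>

lemma Ap_weak:
  assumes [measurable]: "f \<in> borel_measurable M" and t: "0 < t"
  shows "ennreal (t powr p) * (\<integral>\<^sup>+x. ennreal (w x) * indicator {x. ennreal t < cell_max cell M f x} x \<partial>M) \<le>
    ennreal (A * (2 powr p * p / (p - 1))) * (\<integral>\<^sup>+x. enn_powr (f x) p * ennreal (w x) \<partial>M)"
proof -
  obtain P where P: "countable P" "disjoint P" "P \<subseteq> (\<Union>i. range (cell i))"
    "\<And>Q. Q \<in> P \<Longrightarrow> ennreal t < (\<integral>\<^sup>+y\<in>Q. f y \<partial>M) / emeasure M Q"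
    "\<Union>P = {x. ennreal t < cell_max cell M f x}"
    unfolding cell_max_greater
    by (rule stopping_cells[of "\<lambda>Q. ennreal t < (\<integral>\<^sup>+y\<in>Q. f y \<partial>M) / emeasure M Q"]) blast
  have PM: "P \<subseteq> sets M" using P(3) sets_cell by auto
  have [measurable]: "\<Union>P \<in> sets M"
    using P(1) PM by auto
  let ?\<mu> = "density M (\<lambda>x. ennreal (t powr p) * ennreal (w x))"
  let ?\<nu> = "density N\<sigma> (\<lambda>x. ennreal A * enn_powr (dual_max f x) p)"
  have "ennreal (t powr p) * (\<integral>\<^sup>+x. ennreal (w x) * indicator (\<Union>P) x \<partial>M) = emeasure ?\<mu> (\<Union>P)"
    by (simp add: emeasure_density nn_integral_cmult mult.assoc)
  also have "\<dots> \<le> emeasure ?\<nu> (\<Union>P)"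
  proof (rule emeasure_Union_disjoint_mono[OF P(1,2) PM])
    fix Q assume Q: "Q \<in> P"
    then obtain i x where Qc: "Q = cell i x" using P(3) by auto
    have [measurable]: "Q \<in> sets M" using Q PM by auto
    obtain m W S where v: "0 < m" "0 < W" "0 < S"
      "emeasure M Q = ennreal m"
      "(\<integral>\<^sup>+y\<in>Q. ennreal (w y) \<partial>M) = ennreal W" "(\<integral>\<^sup>+y\<in>Q. ennreal (\<sigma> y) \<partial>M) = ennreal S"
      "W * S powr (p - 1) \<le> A * m powr p"
      unfolding Qc by (rule cell_values)
    define F where "F = (\<integral>\<^sup>+z\<in>Q. f z \<partial>M)"
    have "(S / m) powr p * W = S * ((W * S powr (p - 1)) / m powr p)"
      using v by (simp add: powr_divide powr_diff)
    also have "\<dots> \<le> S * A"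
      using v by (intro mult_left_mono) (auto simp: field_simps)
    finally have r: "(S / m) powr p * W \<le> S * A" .
    have "emeasure ?\<mu> Q = ennreal (t powr p) * ennreal W"
      by (simp add: emeasure_density nn_integral_cmult mult.assoc v)
    also have "\<dots> \<le> enn_powr (F / ennreal m) p * ennreal W"
    proof (rule mult_right_mono)
      have "enn_powr (ennreal t) p \<le> enn_powr (F / ennreal m) p"
        using P(4)[OF Q] v p_gt_1 by (intro enn_powr_mono) (auto simp: F_def)
      then show "ennreal (t powr p) \<le> enn_powr (F / ennreal m) p"
        using t by (simp add: enn_powr_ennreal)
    qed simp
    also have "\<dots> = enn_powr (F / ennreal S) p * ennreal ((S / m) powr p * W)"
      using v by (simp add: cell_average_dual[of S m] enn_powr_mult enn_powr_ennreal ennreal_mult mult.assoc)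
    also have "\<dots> \<le> enn_powr (F / ennreal S) p * ennreal (S * A)"
      using r by (intro mult_left_mono ennreal_leI) auto
    also have "\<dots> = ennreal A * enn_powr (F / ennreal S) p * (\<integral>\<^sup>+y\<in>Q. ennreal (\<sigma> y) \<partial>M)"
      using v A_pos by (simp add: ennreal_mult mult_ac)
    also have "\<dots> = (\<integral>\<^sup>+y. (ennreal A * enn_powr (F / ennreal S) p) * (ennreal (\<sigma> y) * indicator Q y) \<partial>M)"
      by (simp add: nn_integral_cmult)
    also have "\<dots> \<le> (\<integral>\<^sup>+y. ennreal (\<sigma> y) * (ennreal A * enn_powr (dual_max f y) p * indicator Q y) \<partial>M)"
    proof (rule nn_integral_mono)
      fix y
      have "y \<in> Q \<Longrightarrow> enn_powr (F / ennreal S) p \<le> enn_powr (dual_max f y) p"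
        using average_le_dual_max[of f y i x] v p_gt_1 Qc by (intro enn_powr_mono) (auto simp: F_def)
      then show "(ennreal A * enn_powr (F / ennreal S) p) * (ennreal (\<sigma> y) * indicator Q y) \<le>
        ennreal (\<sigma> y) * (ennreal A * enn_powr (dual_max f y) p * indicator Q y)"
        by (auto simp: indicator_def mult_ac intro!: mult_left_mono mult_right_mono)
    qed
    also have "\<dots> = emeasure ?\<nu> Q"
      by (simp add: emeasure_density N\<sigma>_def nn_integral_density)
    finally show "emeasure ?\<mu> Q \<le> emeasure ?\<nu> Q" .
  qed auto
  also have "\<dots> \<le> emeasure ?\<nu> (space ?\<nu>)"
    by (rule emeasure_space)
  also have "\<dots> = ennreal A * (\<integral>\<^sup>+x. enn_powr (dual_max f x) p \<partial>N\<sigma>)"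
    by (subst emeasure_density)
      (auto simp: nn_integral_cmult[symmetric] N\<sigma>_def intro!: nn_integral_cong)
  also have "\<dots> \<le> ennreal A * (ennreal (2 powr p * p / (p - 1)) * (\<integral>\<^sup>+x. enn_powr (f x) p * ennreal (w x) \<partial>M))"
    by (intro mult_left_mono dual_max_strong) auto
  also have "\<dots> = ennreal (A * (2 powr p * p / (p - 1))) * (\<integral>\<^sup>+x. enn_powr (f x) p * ennreal (w x) \<partial>M)"
    using A_pos p_gt_1 by (simp add: mult.assoc[symmetric] flip: ennreal_mult)
  finally show ?thesis unfolding P(5) .
qed

end

section \<open>Cubes and shifted dyadic grids\<close>

text \<open>\<open>R\<close> is the set of admissible side lengths: \<open>UNIV\<close> gives
  \<open>maximal\<close>, and \<open>{..<L}\<close> gives the truncation that grids with a top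
  generation can dominate. Both sets are open, which leaves room for enlarging cubes.\<close>

definition cube_max :: "real set \<Rightarrow> ('a::euclidean_space \<Rightarrow> ennreal) \<Rightarrow> 'a \<Rightarrow> ennreal" where
  "cube_max R f x = (SUP Q \<in> {cbox a (a + r *\<^sub>R One) |a r. 0 < r \<and> r \<in> R \<and> x \<in> cbox a (a + r *\<^sub>R One)}.
      (\<integral>\<^sup>+ y. f y * indicator Q y \<partial>lebesgue) / emeasure lebesgue Q)"

lemma maximal_eq_cube_max: "maximal f x = cube_max UNIV f x"
proof -
  have "{Q. is_cube Q \<and> x \<in> Q} = {cbox a (a + r *\<^sub>R One) |a r. 0 < r \<and> r \<in> UNIV \<and> x \<in> cbox a (a + r *\<^sub>R One)}"
    by (auto simp: is_cube_def)
  then show ?thesis by (simp add: maximal_def cube_max_def)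
qed

lemma emeasure_cube: "0 \<le> r \<Longrightarrow>
    emeasure lebesgue (cbox a (a + r *\<^sub>R One :: 'a::euclidean_space)) = ennreal (r ^ DIM('a))"
  by (subst emeasure_completion) (auto simp: emeasure_lborel_cbox_eq inner_simps)

lemma mem_cube: "x \<in> cbox a (a + r *\<^sub>R One) \<longleftrightarrow> (\<forall>b\<in>Basis. a \<bullet> b \<le> x \<bullet> b \<and> x \<bullet> b \<le> a \<bullet> b + r)"
  by (auto simp: mem_box inner_simps)

text \<open>A cube whose average exceeds \<open>t\<close> can be enlarged slightly, so it may be taken to contain
  \<open>x\<close> in its interior.\<close>
lemma open_cube_max_greater:
  fixes f :: "'a::euclidean_space \<Rightarrow> ennreal"
  assumes R: "open R"
  shows "open {x. t < cube_max R f x}"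
proof (subst open_subopen, safe)
  fix x assume "t < cube_max R f x"
  then obtain a r where ar: "0 < r" "r \<in> R" "x \<in> cbox a (a + r *\<^sub>R One)"
    and t: "t < (\<integral>\<^sup>+ y. f y * indicator (cbox a (a + r *\<^sub>R One)) y \<partial>lebesgue) / emeasure lebesgue (cbox a (a + r *\<^sub>R One))"
    unfolding cube_max_def less_SUP_iff by blast
  define I where "I = (\<integral>\<^sup>+ y. f y * indicator (cbox a (a + r *\<^sub>R One)) y \<partial>lebesgue)"
  have t': "t < I / ennreal (r ^ DIM('a))"
    using t unfolding I_def emeasure_cube[OF less_imp_le[OF ar(1)]] .
  have cont: "((\<lambda>e. r + 2 * e) \<longlongrightarrow> r + 2 * 0) (at_right 0)"
    by (intro tendsto_intros)
  have 1: "eventually (\<lambda>e. r + 2 * e \<in> R) (at_right 0)"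
    using cont R ar topological_tendstoD by fastforce
  \<comment> \<open>The numerator \<open>I\<close> is kept from the old cube. A finite quotient
    depends continuously on the side length, and an infinite one stays infinite.\<close>
  have 2: "eventually (\<lambda>e. t < I / ennreal ((r + 2 * e) ^ DIM('a))) (at_right 0)"
  proof (cases I)
    case (real J)
    have "((\<lambda>e. ennreal (J / (r + 2 * e) ^ DIM('a))) \<longlongrightarrow> ennreal (J / (r + 2 * 0) ^ DIM('a))) (at_right 0)"
      using ar by (intro tendsto_intros) auto
    moreover have "t < ennreal (J / (r + 2 * 0) ^ DIM('a))"
      using t' real ar by (simp add: divide_ennreal)
    ultimately have "eventually (\<lambda>e. t < ennreal (J / (r + 2 * e) ^ DIM('a))) (at_right 0)"
      by (rule order_tendstoD)
    moreover have "eventually (\<lambda>e::real. 0 < e) (at_right 0)"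
      by (simp add: eventually_at_right_less)
    ultimately show ?thesis
      by eventually_elim (use real ar in \<open>simp add: divide_ennreal\<close>)
  next
    case top
    then show ?thesis using t' by (auto simp: ennreal_top_divide)
  qed
  have "eventually (\<lambda>e::real. 0 < e) (at_right 0)"
    by (simp add: eventually_at_right_less)
  with 1 2 have "eventually (\<lambda>e. 0 < e \<and> r + 2 * e \<in> R \<and> t < I / ennreal ((r + 2 * e) ^ DIM('a))) (at_right 0)"
    by eventually_elim auto
  then obtain e where e: "0 < e" "r + 2 * e \<in> R" "t < I / ennreal ((r + 2 * e) ^ DIM('a))"
    using eventually_happens'[OF trivial_limit_at_right_real] by blast
  define a' where "a' = a - e *\<^sub>R One"
  let ?Q = "cbox a' (a' + (r + 2 * e) *\<^sub>R One)"
  have "x \<in> box a' (a' + (r + 2 * e) *\<^sub>R One)"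
    using ar e by (force simp: a'_def mem_box inner_simps)
  moreover have "box a' (a' + (r + 2 * e) *\<^sub>R One) \<subseteq> {x. t < cube_max R f x}"
  proof
    fix y assume "y \<in> box a' (a' + (r + 2 * e) *\<^sub>R One)"
    then have y: "y \<in> ?Q" using box_subset_cbox by blast
    have "cbox a (a + r *\<^sub>R One) \<subseteq> ?Q"
      using e by (force simp: a'_def subset_iff mem_box inner_simps)
    then have "I \<le> (\<integral>\<^sup>+ y. f y * indicator ?Q y \<partial>lebesgue)"
      unfolding I_def by (intro nn_integral_mono) (auto simp: indicator_def)
    then have "I / ennreal ((r + 2 * e) ^ DIM('a)) \<le> (\<integral>\<^sup>+ y. f y * indicator ?Q y \<partial>lebesgue) / emeasure lebesgue ?Q"
      using ar e by (subst emeasure_cube) (auto intro: divide_right_mono_ennreal)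
    also have "\<dots> \<le> cube_max R f y"
      unfolding cube_max_def using ar e y by (intro SUP_upper CollectI exI[of _ a'] exI[of _ "r + 2 * e"]) auto
    finally show "y \<in> {x. t < cube_max R f x}" using e by auto
  qed
  ultimately show "\<exists>T. open T \<and> x \<in> T \<and> T \<subseteq> {x. t < cube_max R f x}"
    using open_box by blast
qed

text \<open>Lower semicontinuity yields measurability for every \<open>f\<close>, so iterates are
  measurable at once.\<close>

lemma borel_measurable_cube_max:
  "open R \<Longrightarrow> cube_max R f \<in> borel_measurable lebesgue"
  using open_cube_max_greater[of R _ f]
  by (intro measurable_completion borel_measurableI_greater) auto

lemma borel_measurable_maximal [measurable]: "maximal f \<in> borel_measurable lebesgue"
  using borel_measurable_cube_max[of UNIV f] by (simp add: maximal_eq_cube_max[abs_def])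

lemma maximal_eq_SUP: "maximal f x = (SUP N. cube_max {..<real N} f x)"
proof (rule antisym)
  show "maximal f x \<le> (SUP N. cube_max {..<real N} f x)"
    unfolding maximal_eq_cube_max cube_max_def[of UNIV]
  proof (rule SUP_least, clarify)
    fix a :: 'a and r :: real assume "0 < r" "x \<in> cbox a (a + r *\<^sub>R One)"
    moreover obtain N where "r < real N" using reals_Archimedean2 by blast
    ultimately have "set_nn_integral lebesgue (cbox a (a + r *\<^sub>R One)) f / emeasure lebesgue (cbox a (a + r *\<^sub>R One))
       \<le> cube_max {..<real N} f x"
      unfolding cube_max_def by (intro SUP_upper) auto
    also have "\<dots> \<le> (SUP N. cube_max {..<real N} f x)"
      by (rule SUP_upper) simp
    finally show "set_nn_integral lebesgue (cbox a (a + r *\<^sub>R One)) f / emeasure lebesgue (cbox a (a + r *\<^sub>R One))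
       \<le> (SUP N. cube_max {..<real N} f x)" .
  qed
  show "(SUP N. cube_max {..<real N} f x) \<le> maximal f x"
    unfolding maximal_eq_cube_max cube_max_def by (intro SUP_least SUP_subset_mono) auto
qed

lemma incseq_cube_max: "incseq (\<lambda>N. cube_max {..<real N} f)"
  unfolding cube_max_def by (intro monoI le_funI SUP_subset_mono) force+

text \<open>\<open>B\<close> is the set of shifted coordinate directions. The shift is the same in
  all generations, which keeps each grid nested. All subsets of \<open>Basis\<close> are needed,
  because a cube may require the shift in some directions and not in others.\<close>

definition grid_shift :: "real \<Rightarrow> 'a set \<Rightarrow> 'a \<Rightarrow> real" where
  "grid_shift L B b = (if b \<in> B then L / 3 else 0)"

definition grid_index :: "real \<Rightarrow> 'a set \<Rightarrow> nat \<Rightarrow> 'a::euclidean_space \<Rightarrow> 'a \<Rightarrow> int" where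
  "grid_index L B i x b = \<lfloor>(x \<bullet> b - grid_shift L B b) * 2 ^ i / L\<rfloor>"

definition grid_cell :: "real \<Rightarrow> 'a set \<Rightarrow> nat \<Rightarrow> 'a::euclidean_space \<Rightarrow> 'a set" where
  "grid_cell L B i x = {y. \<forall>b\<in>Basis. grid_index L B i y b = grid_index L B i x b}"

lemma grid_index_eq_iff:
  assumes "0 < L"
  shows "grid_index L B i y b = k \<longleftrightarrow>
    grid_shift L B b + of_int k * (L / 2 ^ i) \<le> y \<bullet> b \<and> y \<bullet> b < grid_shift L B b + of_int k * (L / 2 ^ i) + L / 2 ^ i"
  using assms by (auto simp: grid_index_def floor_eq_iff field_simps)

lemma cell_filtration_grid_cell:
  assumes L: "0 < L"
  shows "cell_filtration (lebesgue :: 'a::euclidean_space measure) (grid_cell L B)"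
proof
  fix i j :: nat and x y :: 'a
  have "{y \<in> space borel. \<forall>b\<in>Basis. grid_index L B i y b = grid_index L B i x b} \<in> sets (borel :: 'a measure)"
    unfolding grid_index_eq_iff[OF L] by measurable
  then show "grid_cell L B i x \<in> sets lebesgue"
    by (simp add: grid_cell_def)
  show "countable (range (grid_cell L B i :: 'a \<Rightarrow> 'a set))"
  proof (rule countable_subset)
    show "range (grid_cell L B i :: 'a \<Rightarrow> 'a set) \<subseteq>
      (\<lambda>k. {y. \<forall>b\<in>Basis. grid_index L B i y b = k b}) ` (PiE Basis (\<lambda>_. UNIV))"
      by (auto simp: grid_cell_def intro!: image_eqI[where x = "restrict (grid_index L B i _) Basis"])
  qed (auto intro!: countable_PiE)
  show "grid_cell L B j x \<subseteq> grid_cell L B i x" if "i \<le> j"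
  proof -
    \<comment> \<open>Integer division recovers the coarser index from the finer one; this is the
      nesting of the generations.\<close>
    have "grid_index L B i z b = grid_index L B j z b div 2 ^ (j - i)" for z b :: 'a
    proof -
      have "(z \<bullet> b - grid_shift L B b) * 2 ^ i / L = (z \<bullet> b - grid_shift L B b) * 2 ^ j / L / real_of_int (2 ^ (j - i))"
      proof -
        have "(2::real) ^ j = 2 ^ i * 2 ^ (j - i)"
          using that by (simp flip: power_add)
        then show ?thesis by simp
      qed
      then show ?thesis
        unfolding grid_index_def by (simp only: floor_divide_real_eq_div zero_le_power zero_le_numeral)
    qed
    then show ?thesis by (auto simp: grid_cell_def)
  qed
qed (auto simp: grid_cell_def)

text \<open>Cells are half-open and cubes closed; they differ in part of the frontier, a null
  set.\<close>

lemma grid_cell_cube: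
  fixes x :: "'a::euclidean_space"
  assumes L: "0 < L"
  obtains a where "AE y in lebesgue. y \<in> grid_cell L B i x \<longleftrightarrow> y \<in> cbox a (a + (L / 2 ^ i) *\<^sub>R One)"
proof -
  define a where "a = (\<Sum>b\<in>Basis. (grid_shift L B b + of_int (grid_index L B i x b) * (L / 2 ^ i)) *\<^sub>R b)"
  let ?Q = "cbox a (a + (L / 2 ^ i) *\<^sub>R One)"
  have ab: "a \<bullet> b = grid_shift L B b + of_int (grid_index L B i x b) * (L / 2 ^ i)" if "b \<in> Basis" for b
    using that by (simp add: a_def)
  have "negligible (?Q - box a (a + (L / 2 ^ i) *\<^sub>R One))"
    by (rule negligible_frontier_interval)
  then have "AE y in lebesgue. y \<notin> ?Q - box a (a + (L / 2 ^ i) *\<^sub>R One)"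
    unfolding negligible_iff_null_sets by (rule AE_not_in)
  then have "AE y in lebesgue. y \<in> grid_cell L B i x \<longleftrightarrow> y \<in> ?Q"
  proof eventually_elim
    case (elim y)
    have "y \<in> box a (a + (L / 2 ^ i) *\<^sub>R One) \<Longrightarrow> y \<in> grid_cell L B i x"
      by (auto simp: grid_cell_def grid_index_eq_iff[OF L] mem_box inner_simps ab less_imp_le)
    moreover have "y \<in> grid_cell L B i x \<Longrightarrow> y \<in> ?Q"
      by (auto simp: grid_cell_def grid_index_eq_iff[OF L] mem_box inner_simps ab less_imp_le)
    ultimately show ?case using elim by auto
  qed
  then show ?thesis by (rule that)
qed

text \<open>The one-third trick: grid points of the unshifted and the shifted grid of side \<open>L / 2 ^ i\<close>
  are at distance at least a third of that side, because \<open>3\<close> does not divide \<open>2 ^ i\<close>.\<close>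
lemma one_third_trick:
  fixes u r L :: real
  assumes L: "0 < L" and r: "0 \<le> r" "3 * r < L / 2 ^ i"
    and no0: "\<lfloor>u * 2 ^ i / L\<rfloor> \<noteq> \<lfloor>(u + r) * 2 ^ i / L\<rfloor>"
  shows "\<lfloor>(u - L / 3) * 2 ^ i / L\<rfloor> = \<lfloor>(u + r - L / 3) * 2 ^ i / L\<rfloor>"
proof (rule ccontr)
  assume no1: "\<not> ?thesis"
  define v where "v = u * 2 ^ i / L"
  define d where "d = r * 2 ^ i / L"
  have d: "0 \<le> d" "3 * d < 1" using r L by (auto simp: d_def field_simps)
  have e: "(u + r) * 2 ^ i / L = v + d" "(u - L / 3) * 2 ^ i / L = v - 2 ^ i / 3"
    "(u + r - L / 3) * 2 ^ i / L = v + d - 2 ^ i / 3"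
    using L by (auto simp: v_def d_def field_simps)
  have "\<lfloor>v\<rfloor> < \<lfloor>v + d\<rfloor>"
    using no0 d floor_mono[of v "v + d"] unfolding e v_def[symmetric] by linarith
  moreover have "\<lfloor>v - 2 ^ i / 3\<rfloor> < \<lfloor>v + d - 2 ^ i / 3\<rfloor>"
    using no1 d floor_mono[of "v - 2 ^ i / 3" "v + d - 2 ^ i / 3"] unfolding e by linarith
  ultimately have m: "v < of_int \<lfloor>v + d\<rfloor>" "of_int \<lfloor>v + d\<rfloor> \<le> v + d"
     "v - 2 ^ i / 3 < of_int \<lfloor>v + d - 2 ^ i / 3\<rfloor>" "of_int \<lfloor>v + d - 2 ^ i / 3\<rfloor> \<le> v + d - 2 ^ i / 3"
    by linarith+
  \<comment> \<open>The two larger floors are integers in half-open intervals of length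
    \<open>d\<close> whose offset is \<open>2 ^ i / 3\<close>. Their difference is within
    \<open>d < 1 / 3\<close> of that offset, so \<open>3 * k\<close> and \<open>2 ^ i\<close> are
    integers less than 1 apart.\<close>
  define k where "k = \<lfloor>v + d\<rfloor> - \<lfloor>v + d - 2 ^ i / 3\<rfloor>"
  have "\<bar>real_of_int (3 * k - 2 ^ i)\<bar> < 1"
    using m d by (simp add: k_def) linarith
  then have "3 * k = 2 ^ i" by linarith
  then have "(3::int) dvd 2 ^ i" by (metis dvd_triv_left)
  then show False
    using prime_dvd_power_int[of 3 2 i] by auto
qed

lemma dyadic_scale:
  fixes L r :: real
  assumes r: "0 < r" "r < L"
  obtains i :: nat where "r < L / 2 ^ i" "L / 2 ^ i \<le> 2 * r"
proof -
  obtain n where "L / r < 2 ^ n"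
    using real_arch_pow[of 2 "L / r"] by auto
  then have ex: "\<exists>n. L / 2 ^ n \<le> r"
    using r by (auto simp: field_simps intro!: exI[of _ n])
  define n where "n = (LEAST n. L / 2 ^ n \<le> r)"
  have n: "L / 2 ^ n \<le> r" unfolding n_def using ex by (rule LeastI_ex)
  \<comment> \<open>Generation \<open>0\<close> has side \<open>L > r\<close>, so a generation one
    step coarser than \<open>n\<close> exists.\<close>
  then have "n \<noteq> 0" using r by (intro notI) auto
  then obtain i where i: "n = Suc i" using not0_implies_Suc by blast
  have "\<not> L / 2 ^ i \<le> r"
    using i not_less_Least[of i "\<lambda>n. L / 2 ^ n \<le> r"] by (simp add: n_def)
  with n i show ?thesis by (intro that[of i]) (auto simp: field_simps)
qed

text \<open>The factor 6 is the 3 required by the one-third trick times the 2 lost in rounding to a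
  dyadic scale.\<close>

lemma cube_subset_grid_cell:
  fixes a :: "'a::euclidean_space"
  assumes r: "0 < r" "3 * r < L"
  obtains B i where "B \<subseteq> Basis" "L / 2 ^ i \<le> 6 * r"
    "\<And>x. x \<in> cbox a (a + r *\<^sub>R One) \<Longrightarrow> cbox a (a + r *\<^sub>R One) \<subseteq> grid_cell L B i x"
proof -
  have L: "0 < L" using r by linarith
  obtain i where i: "3 * r < L / 2 ^ i" "L / 2 ^ i \<le> 2 * (3 * r)"
    using dyadic_scale[of "3 * r" L] r by auto
  \<comment> \<open>Shift exactly those directions in which the unshifted grid separates the two
    ends of the cube.\<close>
  define B where "B = {b \<in> Basis. \<lfloor>(a \<bullet> b) * 2 ^ i / L\<rfloor> \<noteq> \<lfloor>(a \<bullet> b + r) * 2 ^ i / L\<rfloor>}"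
  have same: "\<lfloor>(a \<bullet> b - grid_shift L B b) * 2 ^ i / L\<rfloor> = \<lfloor>(a \<bullet> b + r - grid_shift L B b) * 2 ^ i / L\<rfloor>"
    if "b \<in> Basis" for b
    using one_third_trick[OF L _ i(1), of "a \<bullet> b"] r that by (auto simp: grid_shift_def B_def)
  have idx: "grid_index L B i x b = \<lfloor>(a \<bullet> b - grid_shift L B b) * 2 ^ i / L\<rfloor>"
    if "x \<in> cbox a (a + r *\<^sub>R One)" "b \<in> Basis" for x b
  proof -
    have "a \<bullet> b \<le> x \<bullet> b" "x \<bullet> b \<le> a \<bullet> b + r" using that by (auto simp: mem_cube)
    then have "\<lfloor>(a \<bullet> b - grid_shift L B b) * 2 ^ i / L\<rfloor> \<le> grid_index L B i x b"
      "grid_index L B i x b \<le> \<lfloor>(a \<bullet> b + r - grid_shift L B b) * 2 ^ i / L\<rfloor>"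
      unfolding grid_index_def using L by (auto intro!: floor_mono divide_right_mono mult_right_mono)
    with same[OF that(2)] show ?thesis by simp
  qed
  show ?thesis
    by (rule that[of B i]) (use i idx in \<open>auto simp: B_def grid_cell_def\<close>)
qed

text \<open>The covering cell has side at most \<open>6 * r\<close>, hence at most
  \<open>6 ^ DIM('a)\<close> times the volume of the cube. Top side \<open>3 * L\<close> makes the
  one-third trick apply to all sides below \<open>L\<close>.\<close>

lemma cube_max_le_grid:
  fixes f :: "'a::euclidean_space \<Rightarrow> ennreal"
  assumes L: "0 < L"
  shows "cube_max {..<L} f x \<le>
    ennreal (6 ^ DIM('a)) * (SUP B\<in>Pow Basis. cell_max (grid_cell (3 * L) B) lebesgue f x)"
  unfolding cube_max_def
proof (rule SUP_least, clarify)
  fix a r assume r: "0 < r" "r < L" "x \<in> cbox a (a + r *\<^sub>R One)"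
  let ?Q = "cbox a (a + r *\<^sub>R One)"
  obtain B i where B: "B \<subseteq> Basis" "3 * L / 2 ^ i \<le> 6 * r" and sub: "?Q \<subseteq> grid_cell (3 * L) B i x"
  proof (rule cube_subset_grid_cell[of r "3 * L" a])
    show "0 < r" "3 * r < 3 * L" using r by auto
  qed (use r(3) in blast)
  let ?C = "grid_cell (3 * L) B i x"
  interpret cell_filtration lebesgue "grid_cell (3 * L) B" using L by (intro cell_filtration_grid_cell) auto
  obtain a' where a': "AE y in lebesgue. y \<in> ?C \<longleftrightarrow> y \<in> cbox a' (a' + (3 * L / 2 ^ i) *\<^sub>R One)"
    by (rule grid_cell_cube[of "3 * L"]) (use L in auto)
  have C: "emeasure lebesgue ?C = ennreal ((3 * L / 2 ^ i) ^ DIM('a))"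
    using emeasure_eq_AE[OF a'] sets_cell L emeasure_cube[of "3 * L / 2 ^ i" a'] by simp
  have "(\<integral>\<^sup>+ y. f y * indicator ?Q y \<partial>lebesgue) / emeasure lebesgue ?Q \<le> (\<integral>\<^sup>+ y. f y * indicator ?C y \<partial>lebesgue) / ennreal (r ^ DIM('a))"
    using sub r by (subst emeasure_cube) (auto simp: indicator_def intro!: divide_right_mono_ennreal nn_integral_mono)
  also have "\<dots> \<le> ennreal (6 ^ DIM('a)) * ((\<integral>\<^sup>+ y. f y * indicator ?C y \<partial>lebesgue) / emeasure lebesgue ?C)"
  proof -
    have "(3 * L / 2 ^ i) ^ DIM('a) \<le> (6 * r) ^ DIM('a)"
      using B(2) L by (intro power_mono) auto
    then have *: "inverse (r ^ DIM('a)) \<le> 6 ^ DIM('a) * inverse ((3 * L / 2 ^ i) ^ DIM('a))"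
      using r L by (simp add: field_simps power_mult_distrib)
    have "ennreal (inverse (r ^ DIM('a))) \<le> ennreal (6 ^ DIM('a)) * ennreal (inverse ((3 * L / 2 ^ i) ^ DIM('a)))"
      using * L by (subst ennreal_mult[symmetric]) (auto intro!: ennreal_leI)
    then show ?thesis
      unfolding C divide_ennreal_def using r L
      by (subst (1 2) inverse_ennreal)
        (auto simp: mult.left_commute[of "ennreal (6 ^ DIM('a))"] intro!: mult_left_mono)
  qed
  also have "\<dots> \<le> ennreal (6 ^ DIM('a)) * (SUP B\<in>Pow Basis. cell_max (grid_cell (3 * L) B) lebesgue f x)"
    using B(1) by (intro mult_left_mono SUP_upper2[of B]) (auto simp: cell_max_def intro!: SUP_upper2[of i])
  finally show "(\<integral>\<^sup>+ y. f y * indicator ?Q y \<partial>lebesgue) / emeasure lebesgue ?Q \<le> \<dots>" .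
qed

section \<open>The upper bound\<close>

lemma sigma_finite_lebesgue: "sigma_finite_measure (lebesgue :: 'a::euclidean_space measure)"
proof
  let ?F = "range (\<lambda>n::nat. cball (0::'a) (real n))"
  have "x \<in> \<Union>?F" for x
    using real_arch_simple[of "norm x"] by auto
  then show "\<exists>A. countable A \<and> A \<subseteq> sets lebesgue \<and> \<Union> A = space (lebesgue :: 'a measure) \<and> (\<forall>a\<in>A. emeasure lebesgue a \<noteq> \<infinity>)"
    using emeasure_lborel_cball_finite[of "0::'a"] by (intro exI[of _ ?F]) (auto simp: less_top)
qed

text \<open>An \<open>A\<^sub>p\<close> weight is positive only almost everywhere.\<close>
definition pos_weight :: "('a \<Rightarrow> real) \<Rightarrow> 'a \<Rightarrow> real" where
  "pos_weight w x = (if 0 < w x then w x else 1)"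

lemma pos_weight_pos: "0 < pos_weight w x"
  by (simp add: pos_weight_def)

lemma AE_pos_weight: "Ap_weight p w \<Longrightarrow> AE x in lebesgue. pos_weight w x = w x"
  unfolding Ap_weight_def pos_weight_def by (elim conjE eventually_mono) simp

lemma borel_measurable_pos_weight: "Ap_weight p w \<Longrightarrow> pos_weight w \<in> borel_measurable lebesgue"
proof -
  assume "Ap_weight p w"
  then have [measurable]: "w \<in> borel_measurable lebesgue"
    by (simp add: Ap_weight_def)
  show ?thesis
    unfolding pos_weight_def[abs_def] by measurable
qed

section \<open>The \<open>A_p\<close> condition on cubes and on grid cells\<close>

lemma set_nn_integral_eq_avg:
  assumes int: "set_integrable lebesgue Q u" and nn: "AE x in lebesgue. 0 \<le> u x"
    and m: "measure lebesgue Q = m" "0 < m"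
  shows "(\<integral>\<^sup>+x\<in>Q. ennreal (u x) \<partial>lebesgue) = ennreal (m * avg Q u)" "0 \<le> avg Q u"
proof -
  have "(\<integral>\<^sup>+x\<in>Q. ennreal (u x) \<partial>lebesgue) = (\<integral>\<^sup>+x. ennreal (indicator Q x *\<^sub>R u x) \<partial>lebesgue)"
    by (intro nn_integral_cong) (auto simp: indicator_def)
  also have "\<dots> = ennreal (set_lebesgue_integral lebesgue Q u)"
    unfolding set_lebesgue_integral_def using int nn
    by (intro nn_integral_eq_integral) (auto simp: set_integrable_def elim!: eventually_mono)
  finally show "(\<integral>\<^sup>+x\<in>Q. ennreal (u x) \<partial>lebesgue) = ennreal (m * avg Q u)"
    using m by (simp add: avg_def)
  have "0 \<le> set_lebesgue_integral lebesgue Q u"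
    unfolding set_lebesgue_integral_def using nn
    by (intro integral_nonneg_AE) (auto elim!: eventually_mono)
  then show "0 \<le> avg Q u" using m by (simp add: avg_def)
qed

lemma Ap_weight_cube:
  fixes w :: "'a::euclidean_space \<Rightarrow> real" and a :: 'a
  assumes w: "Ap_weight p w" and p: "1 < p" and r: "0 < r"
  defines "Q \<equiv> cbox a (a + r *\<^sub>R One)"
  shows "(\<integral>\<^sup>+x\<in>Q. ennreal (w x) \<partial>lebesgue) < \<infinity>"
    and "(\<integral>\<^sup>+x\<in>Q. ennreal (w x powr (- 1 / (p - 1))) \<partial>lebesgue) < \<infinity>"
    and "(\<integral>\<^sup>+x\<in>Q. ennreal (w x) \<partial>lebesgue) * enn_powr (\<integral>\<^sup>+x\<in>Q. ennreal (w x powr (- 1 / (p - 1))) \<partial>lebesgue) (p - 1)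
      \<le> ennreal (Ap_const p w) * enn_powr (emeasure lebesgue Q) p"
    and "0 < Ap_const p w"
proof -
  let ?s = "\<lambda>x. w x powr (- 1 / (p - 1))"
  have Q: "is_cube Q" using r by (auto simp: is_cube_def Q_def)
  define m where "m = r ^ DIM('a)"
  have m: "0 < m" "emeasure lebesgue Q = ennreal m" "measure lebesgue Q = m"
    using r emeasure_cube[of r a] by (auto simp: m_def Q_def measure_def)
  have int: "set_integrable lebesgue Q w" "set_integrable lebesgue Q ?s"
    using w Q by (auto simp: Ap_weight_def)
  have pos: "AE x in lebesgue. 0 < w x" using w by (auto simp: Ap_weight_def)
  have nn: "AE x in lebesgue. 0 \<le> w x" "AE x in lebesgue. 0 \<le> ?s x"
    using pos by (auto elim: eventually_mono)
  note W = set_nn_integral_eq_avg[OF int(1) nn(1) m(3,1)] and S = set_nn_integral_eq_avg[OF int(2) nn(2) m(3,1)]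
  show "(\<integral>\<^sup>+x\<in>Q. ennreal (w x) \<partial>lebesgue) < \<infinity>" "(\<integral>\<^sup>+x\<in>Q. ennreal (?s x) \<partial>lebesgue) < \<infinity>"
    unfolding W S by simp_all
  have le: "avg Q w * avg Q ?s powr (p - 1) \<le> Ap_const p w"
    unfolding Ap_const_def using w Q by (intro cSup_upper) (auto simp: Ap_weight_def)
  have [measurable]: "Q \<in> sets lebesgue" by (simp add: Q_def)
  have pw[measurable]: "pos_weight w \<in> borel_measurable lebesgue" by (rule borel_measurable_pos_weight[OF w])
  \<comment> \<open>Positivity of the integral is shown for the everywhere positive modification and
    transferred to \<open>w\<close> almost everywhere.\<close>
  have "0 < (\<integral>\<^sup>+x\<in>Q. ennreal (pos_weight w x) \<partial>lebesgue)"
    using m by (intro nn_integral_pos) (auto simp: pos_weight_pos)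
  also have "\<dots> = (\<integral>\<^sup>+x\<in>Q. ennreal (w x) \<partial>lebesgue)"
    using AE_pos_weight[OF w] by (intro nn_integral_cong_AE) (auto elim!: eventually_mono)
  finally have W0: "0 < avg Q w" using W m by (auto simp: zero_less_mult_iff)
  have "pos_weight w x powr (- 1 / (p - 1)) > 0" for x using pos_weight_pos[of w x] by simp
  then have "0 < (\<integral>\<^sup>+x\<in>Q. ennreal (pos_weight w x powr (- 1 / (p - 1))) \<partial>lebesgue)"
    using m by (intro nn_integral_pos) auto
  also have "\<dots> = (\<integral>\<^sup>+x\<in>Q. ennreal (?s x) \<partial>lebesgue)"
    using AE_pos_weight[OF w] by (intro nn_integral_cong_AE) (auto elim!: eventually_mono)
  finally have S0: "0 < avg Q ?s" using S m by (auto simp: zero_less_mult_iff)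
  show A: "0 < Ap_const p w" using le W0 S0 by (smt (verit) mult_pos_pos powr_gt_zero)
  have "(m * avg Q w) * (m * avg Q ?s) powr (p - 1) = m powr p * (avg Q w * avg Q ?s powr (p - 1))"
    using m S W by (simp add: powr_mult powr_diff)
  also have "\<dots> \<le> m powr p * Ap_const p w"
    using le by (intro mult_left_mono) auto
  finally show "(\<integral>\<^sup>+x\<in>Q. ennreal (w x) \<partial>lebesgue) * enn_powr (\<integral>\<^sup>+x\<in>Q. ennreal (w x powr (- 1 / (p - 1))) \<partial>lebesgue) (p - 1)
      \<le> ennreal (Ap_const p w) * enn_powr (emeasure lebesgue Q) p"
    using W S m A unfolding W S m(2)
    by (simp add: enn_powr_ennreal mult.commute flip: ennreal_mult)
qed

lemma Ap_const_pos:
  fixes w :: "'a::euclidean_space \<Rightarrow> real"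
  assumes w: "Ap_weight p w" and p: "1 < p"
  shows "0 < Ap_const p w"
  using Ap_weight_cube(4)[OF w p, of 1] by simp

lemma Ap_cell_filtration_grid:
  fixes w :: "'a::euclidean_space \<Rightarrow> real"
  assumes w: "Ap_weight p w" and p: "1 < p" and L: "0 < L"
  shows "Ap_cell_filtration lebesgue (grid_cell L B) (pos_weight w) p (Ap_const p w)"
proof -
  interpret cell_filtration lebesgue "grid_cell L B" using L by (rule cell_filtration_grid_cell)
  show ?thesis
  proof
    fix i :: nat and x :: 'a
    have r: "0 < L / 2 ^ i" using L by simp
    obtain a where a: "AE y in lebesgue. y \<in> grid_cell L B i x \<longleftrightarrow> y \<in> cbox a (a + (L / 2 ^ i) *\<^sub>R One)"
      using grid_cell_cube[OF L] by blast
    let ?C = "grid_cell L B i x" and ?Q = "cbox a (a + (L / 2 ^ i) *\<^sub>R One)"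
    have m: "emeasure lebesgue ?C = emeasure lebesgue ?Q"
      using a sets_cell by (intro emeasure_eq_AE) auto
    have I: "(\<integral>\<^sup>+y\<in>?C. ennreal (pos_weight w y) \<partial>lebesgue) = (\<integral>\<^sup>+y\<in>?Q. ennreal (w y) \<partial>lebesgue)"
      using a AE_pos_weight[OF w] by (intro nn_integral_cong_AE, eventually_elim) (auto simp: indicator_def)
    have J: "(\<integral>\<^sup>+y\<in>?C. ennreal (pos_weight w y powr (- 1 / (p - 1))) \<partial>lebesgue) = (\<integral>\<^sup>+y\<in>?Q. ennreal (w y powr (- 1 / (p - 1))) \<partial>lebesgue)"
      using a AE_pos_weight[OF w] by (intro nn_integral_cong_AE, eventually_elim) (auto simp: indicator_def)
    show "0 < emeasure lebesgue ?C" "emeasure lebesgue ?C < \<infinity>"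
      unfolding m emeasure_cube[OF less_imp_le[OF r]] using r by auto
    show "(\<integral>\<^sup>+y\<in>?C. ennreal (pos_weight w y) \<partial>lebesgue) < \<infinity>"
      "(\<integral>\<^sup>+y\<in>?C. ennreal (pos_weight w y powr (- 1 / (p - 1))) \<partial>lebesgue) < \<infinity>"
      "(\<integral>\<^sup>+y\<in>?C. ennreal (pos_weight w y) \<partial>lebesgue) * enn_powr (\<integral>\<^sup>+y\<in>?C. ennreal (pos_weight w y powr (- 1 / (p - 1))) \<partial>lebesgue) (p - 1)
       \<le> ennreal (Ap_const p w) * enn_powr (emeasure lebesgue ?C) p"
      unfolding I J m by (rule Ap_weight_cube[OF w p r])+
  qed (rule p pos_weight_pos Ap_const_pos[OF w p] borel_measurable_pos_weight[OF w]
      sigma_finite_measure.sigma_finite_countable[OF sigma_finite_lebesgue])+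
qed

text \<open>Here \<open>(6 ^ n) powr p\<close> is the cost of passing from cubes to grid cells,
  \<open>2 ^ n\<close> the number of grids, and the rest the interpolation constants of the
  operators for \<open>w dx\<close> (exponent \<open>p / (p - 1)\<close>) and
  \<open>\<sigma> dx\<close> (exponent \<open>p\<close>). \<open>weak_const\<close> contains only
  the last one.\<close>

definition strong_const :: "nat \<Rightarrow> real \<Rightarrow> real" where
  "strong_const n p = (6 ^ n) powr p * 2 ^ n * ((2 powr (p / (p - 1)) * p) * (2 powr p * p / (p - 1)))"

definition weak_const :: "nat \<Rightarrow> real \<Rightarrow> real" where
  "weak_const n p = (6 ^ n) powr p * 2 ^ n * (2 powr p * p / (p - 1))"

lemma strong_const_pos: "1 < p \<Longrightarrow> 0 < strong_const n p"
  and weak_const_pos: "1 < p \<Longrightarrow> 0 < weak_const n p"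
  by (simp_all add: strong_const_def weak_const_def)

text \<open>The supremum over the grids is replaced by a sum. The bound is uniform in
  \<open>L\<close>, as needed for the limit of unrestricted cubes.\<close>

lemma cube_max_strong:
  fixes w :: "'a::euclidean_space \<Rightarrow> real"
  assumes w: "Ap_weight p w" and p: "1 < p" and L: "0 < L" and [measurable]: "f \<in> borel_measurable lebesgue"
  shows "(\<integral>\<^sup>+x. enn_powr (cube_max {..<L} f x) p * ennreal (pos_weight w x) \<partial>lebesgue) \<le>
    ennreal (strong_const DIM('a) p * Ap_const p w powr (p / (p - 1))) *
      (\<integral>\<^sup>+x. enn_powr (f x) p * ennreal (pos_weight w x) \<partial>lebesgue)"
proof -
  let ?w = "pos_weight w" and ?M = "\<lambda>B. cell_max (grid_cell (3 * L) B) lebesgue f"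
  let ?J = "\<integral>\<^sup>+x. enn_powr (f x) p * ennreal (?w x) \<partial>lebesgue"
  define c where "c = (2 powr (p / (p - 1)) * p) * (2 powr p * p / (p - 1))"
  define A where "A = Ap_const p w powr (p / (p - 1))"
  note [measurable] = borel_measurable_pos_weight[OF w]
  have 1: "(\<integral>\<^sup>+x. enn_powr (?M B x) p * ennreal (?w x) \<partial>lebesgue) \<le> ennreal (A * c) * ?J"
    and [measurable]: "?M B \<in> borel_measurable lebesgue" for B
  proof -
    interpret Ap_cell_filtration lebesgue "grid_cell (3 * L) B" ?w p "Ap_const p w"
      using L by (intro Ap_cell_filtration_grid[OF w p]) auto
    show "?M B \<in> borel_measurable lebesgue" by measurable
    show "(\<integral>\<^sup>+x. enn_powr (?M B x) p * ennreal (?w x) \<partial>lebesgue) \<le> ennreal (A * c) * ?J"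
      unfolding A_def c_def using Ap_strong[of f] by (simp add: mult.assoc)
  qed
  have pt: "enn_powr (cube_max {..<L} f x) p \<le> ennreal ((6 ^ DIM('a)) powr p) * (\<Sum>B\<in>Pow Basis. enn_powr (?M B x) p)" for x
  proof -
    have "enn_powr (cube_max {..<L} f x) p \<le> enn_powr (ennreal (6 ^ DIM('a)) * (SUP B\<in>Pow Basis. ?M B x)) p"
      using cube_max_le_grid[OF L] p by (intro enn_powr_mono) auto
    also have "\<dots> = ennreal ((6 ^ DIM('a)) powr p) * (SUP B\<in>Pow Basis. enn_powr (?M B x) p)"
      using p by (simp add: enn_powr_mult enn_powr_SUP enn_powr_ennreal)
    also have "\<dots> \<le> ennreal ((6 ^ DIM('a)) powr p) * (\<Sum>B\<in>Pow Basis. enn_powr (?M B x) p)"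
      by (intro mult_left_mono SUP_least member_le_sum) auto
    finally show ?thesis .
  qed
  have "(\<integral>\<^sup>+x. enn_powr (cube_max {..<L} f x) p * ennreal (?w x) \<partial>lebesgue) \<le>
    (\<integral>\<^sup>+x. ennreal ((6 ^ DIM('a)) powr p) * (\<Sum>B\<in>Pow Basis. enn_powr (?M B x) p * ennreal (?w x)) \<partial>lebesgue)"
    using pt by (intro nn_integral_mono) (auto simp: sum_distrib_right[symmetric] mult.assoc[symmetric] intro!: mult_right_mono)
  also have "\<dots> = ennreal ((6 ^ DIM('a)) powr p) * (\<Sum>B\<in>Pow Basis. (\<integral>\<^sup>+x. enn_powr (?M B x) p * ennreal (?w x) \<partial>lebesgue))"
    by (simp add: nn_integral_cmult nn_integral_sum)
  also have "\<dots> \<le> ennreal ((6 ^ DIM('a)) powr p) * (\<Sum>B\<in>Pow (Basis :: 'a set). ennreal (A * c) * ?J)"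
    by (intro mult_left_mono sum_mono 1) auto
  also have "\<dots> = ennreal ((6 ^ DIM('a)) powr p) * (ennreal (2 ^ DIM('a)) * (ennreal (A * c) * ?J))"
    by (simp add: card_Pow ennreal_power[symmetric])
  also have "\<dots> = ennreal (strong_const DIM('a) p * A) * ?J"
  proof -
    have nn: "0 \<le> A" "0 \<le> c" using p by (auto simp: A_def c_def)
    have "strong_const DIM('a) p * A = (6 ^ DIM('a)) powr p * (2 ^ DIM('a) * (A * c))"
      by (simp add: strong_const_def c_def)
    then have "ennreal (strong_const DIM('a) p * A) = ennreal ((6 ^ DIM('a)) powr p) * (ennreal (2 ^ DIM('a)) * ennreal (A * c))"
      using nn by (simp only: ennreal_mult mult_nonneg_nonneg powr_ge_zero zero_le_power zero_le_numeral)
    then show ?thesis by (simp only: mult.assoc)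
  qed
  finally show ?thesis by (simp add: A_def)
qed

lemma cube_max_weak:
  fixes w :: "'a::euclidean_space \<Rightarrow> real"
  assumes w: "Ap_weight p w" and p: "1 < p" and L: "0 < L" and [measurable]: "f \<in> borel_measurable lebesgue"
    and t: "0 < t"
  shows "ennreal (t powr p) * (\<integral>\<^sup>+x. ennreal (pos_weight w x) * indicator {x. ennreal t < cube_max {..<L} f x} x \<partial>lebesgue) \<le>
    ennreal (weak_const DIM('a) p * Ap_const p w) *
      (\<integral>\<^sup>+x. enn_powr (f x) p * ennreal (pos_weight w x) \<partial>lebesgue)"
proof -
  let ?w = "pos_weight w" and ?M = "\<lambda>B. cell_max (grid_cell (3 * L) B) lebesgue f"
  let ?J = "\<integral>\<^sup>+x. enn_powr (f x) p * ennreal (?w x) \<partial>lebesgue"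
  define c where "c = 2 powr p * p / (p - 1)"
  define A where "A = Ap_const p w"
  \<comment> \<open>The grids dominate with factor \<open>6 ^ DIM('a)\<close>, so a point above
    level \<open>t\<close> is above level \<open>s\<close> for some grid.\<close>
  define s where "s = t / 6 ^ DIM('a)"
  have s: "0 < s" "t = 6 ^ DIM('a) * s" using t by (auto simp: s_def)
  note [measurable] = borel_measurable_pos_weight[OF w]
  have A: "0 < A" unfolding A_def by (rule Ap_const_pos[OF w p])
  let ?E = "\<lambda>B. {x. ennreal s < ?M B x}"
  have 1: "ennreal (s powr p) * (\<integral>\<^sup>+x. ennreal (?w x) * indicator (?E B) x \<partial>lebesgue) \<le> ennreal (A * c) * ?J"
    and [measurable]: "?E B \<in> sets lebesgue" for B
  proof -
    interpret Ap_cell_filtration lebesgue "grid_cell (3 * L) B" ?w p "Ap_const p w"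
      using L by (intro Ap_cell_filtration_grid[OF w p]) auto
    show "?E B \<in> sets lebesgue" using sets_ex_cell by (simp add: cell_max_greater)
    show "ennreal (s powr p) * (\<integral>\<^sup>+x. ennreal (?w x) * indicator (?E B) x \<partial>lebesgue) \<le> ennreal (A * c) * ?J"
      unfolding A_def c_def using Ap_weak[of f s] s by simp
  qed
  have pt: "indicator {x. ennreal t < cube_max {..<L} f x} x \<le> (\<Sum>B\<in>Pow Basis. indicator (?E B) x :: ennreal)" for x
  proof (cases "ennreal t < cube_max {..<L} f x")
    case True
    have "ennreal (6 ^ DIM('a)) * ennreal s < ennreal (6 ^ DIM('a)) * (SUP B\<in>Pow Basis. ?M B x)"
      using True cube_max_le_grid[OF L, of f x] s by (simp add: ennreal_mult)
    then have "ennreal s < (SUP B\<in>Pow Basis. ?M B x)"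
      by (metis leD leI mult_left_mono zero_le)
    then obtain B where B: "B \<in> Pow Basis" "x \<in> ?E B"
      by (auto simp: less_SUP_iff)
    have "indicator (?E B) x \<le> (\<Sum>B\<in>Pow Basis. indicator (?E B) x :: ennreal)"
      using B by (intro member_le_sum) auto
    then show ?thesis using B True by simp
  qed simp
  have "ennreal (t powr p) * (\<integral>\<^sup>+x. ennreal (?w x) * indicator {x. ennreal t < cube_max {..<L} f x} x \<partial>lebesgue) \<le>
    ennreal (t powr p) * (\<integral>\<^sup>+x. (\<Sum>B\<in>Pow Basis. ennreal (?w x) * indicator (?E B) x) \<partial>lebesgue)"
    using pt by (intro mult_left_mono nn_integral_mono) (auto simp: sum_distrib_left[symmetric] intro!: mult_left_mono)
  also have "\<dots> = ennreal (t powr p) * (\<Sum>B\<in>Pow Basis. (\<integral>\<^sup>+x. ennreal (?w x) * indicator (?E B) x \<partial>lebesgue))"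
    by (subst nn_integral_sum) auto
  also have "\<dots> = ennreal ((6 ^ DIM('a)) powr p) * (\<Sum>B\<in>Pow Basis. ennreal (s powr p) * (\<integral>\<^sup>+x. ennreal (?w x) * indicator (?E B) x \<partial>lebesgue))"
    using s by (simp add: powr_mult ennreal_mult mult.assoc sum_distrib_left)
  also have "\<dots> \<le> ennreal ((6 ^ DIM('a)) powr p) * (\<Sum>B\<in>Pow (Basis :: 'a set). ennreal (A * c) * ?J)"
    by (intro mult_left_mono sum_mono 1) auto
  also have "\<dots> = ennreal ((6 ^ DIM('a)) powr p) * (ennreal (2 ^ DIM('a)) * (ennreal (A * c) * ?J))"
    by (simp add: card_Pow ennreal_power[symmetric])
  also have "\<dots> = ennreal (weak_const DIM('a) p * A) * ?J"
  proof -
    have nn: "0 \<le> A" "0 \<le> c" using p A by (auto simp: c_def)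
    have "weak_const DIM('a) p * A = (6 ^ DIM('a)) powr p * (2 ^ DIM('a) * (A * c))"
      by (simp add: weak_const_def c_def)
    then have "ennreal (weak_const DIM('a) p * A) = ennreal ((6 ^ DIM('a)) powr p) * (ennreal (2 ^ DIM('a)) * ennreal (A * c))"
      using nn by (simp only: ennreal_mult mult_nonneg_nonneg powr_ge_zero zero_le_power zero_le_numeral)
    then show ?thesis by (simp only: mult.assoc)
  qed
  finally show ?thesis by (simp add: A_def)
qed

section \<open>From bounded cubes to the full maximal operator and its iterates\<close>

lemma nn_integral_pos_weight:
  assumes w: "Ap_weight p w"
  shows "(\<integral>\<^sup>+x. u x * ennreal (pos_weight w x) \<partial>lebesgue) = (\<integral>\<^sup>+x. u x * ennreal (w x) \<partial>lebesgue)"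
  by (rule nn_integral_cong_AE, rule eventually_mono[OF AE_pos_weight[OF w]]) simp

lemma maximal_strong:
  fixes w :: "'a::euclidean_space \<Rightarrow> real"
  assumes w: "Ap_weight p w" and p: "1 < p" and [measurable]: "f \<in> borel_measurable lebesgue"
  shows "(\<integral>\<^sup>+x. enn_powr (maximal f x) p * ennreal (w x) \<partial>lebesgue) \<le>
    ennreal (strong_const DIM('a) p * Ap_const p w powr (p / (p - 1))) *
      (\<integral>\<^sup>+x. enn_powr (f x) p * ennreal (w x) \<partial>lebesgue)"
proof -
  note [measurable] = borel_measurable_pos_weight[OF w] borel_measurable_cube_max[of "{..<real N}" for N]
  let ?g = "\<lambda>N x. enn_powr (cube_max {..<real N} f x) p * ennreal (pos_weight w x)"
  have "(\<integral>\<^sup>+x. enn_powr (maximal f x) p * ennreal (pos_weight w x) \<partial>lebesgue) = (\<integral>\<^sup>+x. (SUP N. ?g N x) \<partial>lebesgue)"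
    using p by (simp add: maximal_eq_SUP enn_powr_SUP SUP_mult_right_ennreal)
  also have "\<dots> = (SUP N. \<integral>\<^sup>+x. ?g N x \<partial>lebesgue)"
  proof (rule nn_integral_monotone_convergence_SUP)
    show "incseq ?g"
      using incseq_cube_max[of f] p
      by (intro monoI le_funI mult_right_mono enn_powr_mono) (auto dest!: incseqD simp: le_fun_def)
  qed measurable
  also have "\<dots> \<le> ennreal (strong_const DIM('a) p * Ap_const p w powr (p / (p - 1))) *
      (\<integral>\<^sup>+x. enn_powr (f x) p * ennreal (pos_weight w x) \<partial>lebesgue)"
  proof (rule SUP_least)
    fix N :: nat
    \<comment> \<open>Passing to \<open>Suc N\<close> provides the positive length bound that the
      truncated estimate requires, also for \<open>N = 0\<close>.\<close>
    have "(\<integral>\<^sup>+x. ?g N x \<partial>lebesgue) \<le> (\<integral>\<^sup>+x. ?g (Suc N) x \<partial>lebesgue)"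
      using incseq_cube_max[of f] p
      by (intro nn_integral_mono mult_right_mono enn_powr_mono) (auto dest!: incseq_SucD simp: le_fun_def)
    also have "\<dots> \<le> ennreal (strong_const DIM('a) p * Ap_const p w powr (p / (p - 1))) *
      (\<integral>\<^sup>+x. enn_powr (f x) p * ennreal (pos_weight w x) \<partial>lebesgue)"
      by (intro cube_max_strong w p) auto
    finally show "(\<integral>\<^sup>+x. ?g N x \<partial>lebesgue) \<le> \<dots>" .
  qed
  finally show ?thesis unfolding nn_integral_pos_weight[OF w] .
qed

lemma maximal_weak:
  fixes w :: "'a::euclidean_space \<Rightarrow> real"
  assumes w: "Ap_weight p w" and p: "1 < p" and [measurable]: "f \<in> borel_measurable lebesgue"
    and t: "0 < t"
  shows "ennreal (t powr p) * wmeasure w {x. ennreal t < maximal f x} \<le>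
    ennreal (weak_const DIM('a) p * Ap_const p w) * (\<integral>\<^sup>+x. enn_powr (f x) p * ennreal (w x) \<partial>lebesgue)"
proof -
  note [measurable] = borel_measurable_pos_weight[OF w]
  let ?E = "\<lambda>N. {x. ennreal t < cube_max {..<real N} f x}"
  let ?D = "density lebesgue (\<lambda>x. ennreal (pos_weight w x))"
  have meas [measurable]: "?E N \<in> sets lebesgue" for N
    using open_cube_max_greater[of "{..<real N}" "ennreal t" f] by simp
  have inc: "incseq ?E"
    using incseq_cube_max[of f] by (auto simp: incseq_def le_fun_def intro: order.strict_trans2)
  have "ennreal (t powr p) * emeasure ?D (?E N) \<le> ennreal (weak_const DIM('a) p * Ap_const p w) *
      (\<integral>\<^sup>+x. enn_powr (f x) p * ennreal (pos_weight w x) \<partial>lebesgue)" for N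
  proof -
    have "emeasure ?D (?E N) \<le> emeasure ?D (?E (Suc N))"
      by (rule emeasure_mono) (use incseq_SucD[OF inc, of N] meas[of "Suc N"] in simp_all)
    then have "ennreal (t powr p) * emeasure ?D (?E N) \<le> ennreal (t powr p) * emeasure ?D (?E (Suc N))"
      by (rule mult_left_mono) simp
    also have "\<dots> \<le> ennreal (weak_const DIM('a) p * Ap_const p w) *
      (\<integral>\<^sup>+x. enn_powr (f x) p * ennreal (pos_weight w x) \<partial>lebesgue)"
      using cube_max_weak[OF w p, of "real (Suc N)" f t] t meas[of "Suc N"] by (subst emeasure_density) auto
    finally show ?thesis .
  qed
  then have "(SUP N. ennreal (t powr p) * emeasure ?D (?E N)) \<le> ennreal (weak_const DIM('a) p * Ap_const p w) *
      (\<integral>\<^sup>+x. enn_powr (f x) p * ennreal (pos_weight w x) \<partial>lebesgue)"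
    by (rule SUP_least)
  moreover have "(SUP N. emeasure ?D (?E N)) = emeasure ?D (\<Union>N. ?E N)"
    using inc by (intro SUP_emeasure_incseq) auto
  moreover have "(\<Union>N. ?E N) = {x. ennreal t < maximal f x}"
    by (auto simp: maximal_eq_SUP less_SUP_iff)
  moreover have "{x. ennreal t < maximal f x} \<in> sets lebesgue"
    using open_cube_max_greater[of UNIV "ennreal t" f] by (simp add: maximal_eq_cube_max)
  then have "emeasure ?D {x. ennreal t < maximal f x} = wmeasure w {x. ennreal t < maximal f x}"
    using nn_integral_pos_weight[OF w, of "indicator {x. ennreal t < maximal f x}"]
    by (simp add: emeasure_density wmeasure_def mult.commute[of "indicator _ _"])
  ultimately show ?thesis
    unfolding SUP_mult_left_ennreal[symmetric] nn_integral_pos_weight[OF w] by metis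
qed

lemma maximal_iter_strong:
  fixes w :: "'a::euclidean_space \<Rightarrow> real"
  assumes w: "Ap_weight p w" and p: "1 < p" and f: "f \<in> borel_measurable lebesgue"
  shows "(maximal ^^ k) f \<in> borel_measurable lebesgue"
    "(\<integral>\<^sup>+x. enn_powr ((maximal ^^ k) f x) p * ennreal (w x) \<partial>lebesgue) \<le>
      ennreal ((strong_const DIM('a) p * Ap_const p w powr (p / (p - 1))) ^ k) *
      (\<integral>\<^sup>+x. enn_powr (f x) p * ennreal (w x) \<partial>lebesgue)"
proof (induction k)
  case (Suc k)
  let ?c = "strong_const DIM('a) p * Ap_const p w powr (p / (p - 1))"
  have c: "0 \<le> ?c" using strong_const_pos[OF p] by (simp add: less_imp_le)
  show "(maximal ^^ Suc k) f \<in> borel_measurable lebesgue" by simp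
  have "(\<integral>\<^sup>+x. enn_powr ((maximal ^^ Suc k) f x) p * ennreal (w x) \<partial>lebesgue) \<le>
     ennreal ?c * (\<integral>\<^sup>+x. enn_powr ((maximal ^^ k) f x) p * ennreal (w x) \<partial>lebesgue)"
    using maximal_strong[OF w p Suc.IH(1)] by simp
  also have "\<dots> \<le> ennreal ?c * (ennreal (?c ^ k) * (\<integral>\<^sup>+x. enn_powr (f x) p * ennreal (w x) \<partial>lebesgue))"
    by (intro mult_left_mono Suc.IH(2)) auto
  also have "\<dots> = ennreal (?c ^ Suc k) * (\<integral>\<^sup>+x. enn_powr (f x) p * ennreal (w x) \<partial>lebesgue)"
    unfolding power_Suc ennreal_mult[OF c zero_le_power[OF c]] by (simp only: mult.assoc)
  finally show "(\<integral>\<^sup>+x. enn_powr ((maximal ^^ Suc k) f x) p * ennreal (w x) \<partial>lebesgue) \<le> \<dots>" .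
qed (use f in auto)

lemma Mk_norm_le:
  fixes w :: "'a::euclidean_space \<Rightarrow> real"
  assumes w: "Ap_weight p w" and p: "1 < p" and k: "1 \<le> k"
  shows "Mk_norm p k w \<le> ennreal ((weak_const DIM('a) p * strong_const DIM('a) p ^ (k - 1)) powr (1 / p) *
    Ap_const p w powr (1 / p + (real k - 1) / (p - 1)))"
proof -
  define A where "A = Ap_const p w"
  have A: "0 < A" unfolding A_def by (rule Ap_const_pos[OF w p])
  \<comment> \<open>The \<open>p\<close>-th power of the final constant: one weak bound and
    \<open>k - 1\<close> strong ones. The exponent of \<open>A\<close> in the root is
    \<open>(1 + p * (k - 1) / (p - 1)) / p\<close>.\<close>
  define c where "c = weak_const DIM('a) p * A * (strong_const DIM('a) p * A powr (p / (p - 1))) ^ (k - 1)"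
  have c0: "0 < c" using A strong_const_pos[OF p] weak_const_pos[OF p] by (auto simp: c_def intro!: mult_pos_pos zero_less_power)
  have "c = (weak_const DIM('a) p * strong_const DIM('a) p ^ (k - 1)) * (A * (A powr (p / (p - 1))) ^ (k - 1))"
    by (simp add: c_def power_mult_distrib)
  also have "A * (A powr (p / (p - 1))) ^ (k - 1) = A powr (1 + p / (p - 1) * (real k - 1))"
    using A k by (simp add: powr_add powr_powr flip: powr_realpow)
  finally have c_eq: "c = (weak_const DIM('a) p * strong_const DIM('a) p ^ (k - 1)) * A powr (1 + p / (p - 1) * (real k - 1))" .
  have "(1 + p / (p - 1) * (real k - 1)) * (1 / p) = 1 / p + (real k - 1) / (p - 1)"
    using p by (simp add: field_simps)
  then have c: "c powr (1 / p) = (weak_const DIM('a) p * strong_const DIM('a) p ^ (k - 1)) powr (1 / p) *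
    A powr (1 / p + (real k - 1) / (p - 1))"
    using strong_const_pos[OF p, of "DIM('a)"] weak_const_pos[OF p, of "DIM('a)"]
    unfolding c_eq by (subst powr_mult) (simp_all only: powr_powr)
  have "weak_norm p w (maximal_iter k f) / Lp_norm p w f \<le> ennreal (c powr (1 / p))"
    if f: "f \<in> borel_measurable lebesgue" "0 < Lp_norm p w f" "Lp_norm p w f < \<infinity>" for f
  proof (rule divide_le_posI_ennreal[OF f(2)])
    define g where "g = (\<lambda>y. ennreal \<bar>f y\<bar>)"
    define I where "I = (\<integral>\<^sup>+x. enn_powr (g x) p * ennreal (w x) \<partial>lebesgue)"
    have g: "g \<in> borel_measurable lebesgue" using f by (simp add: g_def)
    have LI: "Lp_norm p w f = enn_powr I (1 / p)"
      unfolding Lp_norm_def I_def g_def by (simp add: enn_powr_ennreal ennreal_mult')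
    \<comment> \<open>The outermost operator is split off for the weak bound; this is where
      \<open>k\<close> must be positive.\<close>
    have mk: "maximal_iter k f = maximal ((maximal ^^ (k - 1)) g)"
      using k by (cases k) (auto simp: maximal_iter_def g_def)
    note it = maximal_iter_strong[OF w p g, of "k - 1"]
    show "weak_norm p w (maximal_iter k f) \<le> Lp_norm p w f * ennreal (c powr (1 / p))"
      unfolding weak_norm_def
    proof (rule SUP_least)
      fix t :: real assume "t \<in> {0<..}"
      then have t: "0 < t" by simp
      have "ennreal (t powr p) * wmeasure w {x. ennreal t < maximal_iter k f x} \<le>
        ennreal (weak_const DIM('a) p * A) * (\<integral>\<^sup>+x. enn_powr ((maximal ^^ (k - 1)) g x) p * ennreal (w x) \<partial>lebesgue)"
        unfolding mk A_def by (rule maximal_weak[OF w p it(1) t])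
      also have "\<dots> \<le> ennreal (weak_const DIM('a) p * A) * (ennreal ((strong_const DIM('a) p * A powr (p / (p - 1))) ^ (k - 1)) * I)"
        using it(2) unfolding I_def A_def by (intro mult_left_mono) auto
      also have "\<dots> = ennreal c * I"
        unfolding c_def mult.assoc[symmetric]
        using A strong_const_pos[OF p, of "DIM('a)"] weak_const_pos[OF p, of "DIM('a)"]
        by (subst ennreal_mult[symmetric]) (auto intro!: mult_nonneg_nonneg zero_le_power simp: less_imp_le)
      finally have "enn_powr (ennreal (t powr p) * wmeasure w {x. ennreal t < maximal_iter k f x}) (1 / p) \<le> enn_powr (ennreal c * I) (1 / p)"
        using p by (intro enn_powr_mono) auto
      then show "ennreal t * enn_powr (wmeasure w {x. ennreal t < maximal_iter k f x}) (1 / p) \<le> Lp_norm p w f * ennreal (c powr (1 / p))"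
        using p t c0 by (simp add: LI enn_powr_mult enn_powr_ennreal powr_powr mult.commute)
    qed
  qed
  then show ?thesis
    unfolding Mk_norm_def c[unfolded A_def, symmetric] by (intro SUP_least) auto
qed

section \<open>Power weights and the lower bound\<close>

lemma nn_integral_cube_coord:
  fixes a e :: "'a::euclidean_space" and h :: "real \<Rightarrow> ennreal"
  assumes e: "e \<in> Basis" and r: "0 \<le> r" and [measurable]: "h \<in> borel_measurable borel"
  shows "(\<integral>\<^sup>+x. h (x \<bullet> e) * indicator (cbox a (a + r *\<^sub>R One)) x \<partial>lebesgue) =
    ennreal (r ^ (DIM('a) - 1)) * (\<integral>\<^sup>+t. h t * indicator {a \<bullet> e..a \<bullet> e + r} t \<partial>lborel)"
proof -
  let ?f = "\<lambda>b t. (if b = e then h t else 1) * indicator {a \<bullet> b..a \<bullet> b + r} t"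
  have ind: "(\<Prod>b\<in>Basis. indicator {a \<bullet> b..a \<bullet> b + r} (x \<bullet> b)) = (indicator (cbox a (a + r *\<^sub>R One)) x :: ennreal)" for x
    by (cases "x \<in> cbox a (a + r *\<^sub>R One)") (auto simp: mem_cube indicator_def intro!: prod.neutral)
  have "(\<Prod>b\<in>Basis. if b = e then h (x \<bullet> b) else 1) = h (x \<bullet> e)" for x
    using e prod.delta[of Basis e "\<lambda>b. h (x \<bullet> b)"] by (simp cong: if_cong)
  then have "(\<integral>\<^sup>+x. h (x \<bullet> e) * indicator (cbox a (a + r *\<^sub>R One)) x \<partial>lebesgue) =
     (\<integral>\<^sup>+x. (\<Prod>b\<in>Basis. ?f b (x \<bullet> b)) \<partial>lborel)"
    by (simp add: nn_integral_completion prod.distrib ind)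
  also have "\<dots> = (\<Prod>b\<in>Basis. (\<integral>\<^sup>+t. ?f b t \<partial>lborel))"
    by (rule nn_integral_lborel_prod) auto
  also have "\<dots> = (\<integral>\<^sup>+t. ?f e t \<partial>lborel) * (\<Prod>b\<in>Basis - {e}. (\<integral>\<^sup>+t. ?f b t \<partial>lborel))"
    using e by (intro prod.remove) auto
  also have "(\<Prod>b\<in>Basis - {e}. (\<integral>\<^sup>+t. ?f b t \<partial>lborel)) = (\<Prod>b\<in>Basis - {e}. ennreal r)"
    using r by (intro prod.cong) auto
  also have "\<dots> = ennreal (r ^ (DIM('a) - 1))"
    using e r by (simp add: ennreal_power)
  finally show ?thesis by (simp add: mult.commute)
qed

lemma nn_integral_abs_powr_0:
  assumes "-1 < c" "0 \<le> r"
  shows "(\<integral>\<^sup>+t. ennreal (\<bar>t\<bar> powr c) * indicator {0..r} t \<partial>lborel) = ennreal (r powr (c + 1) / (c + 1))"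
proof -
  have "(\<integral>\<^sup>+t. ennreal (\<bar>t\<bar> powr c) * indicator {0..r} t \<partial>lborel) = (\<integral>\<^sup>+t. ennreal (t powr c) * indicator {0..r} t \<partial>lborel)"
    by (intro nn_integral_cong) (auto simp: indicator_def)
  also have "\<dots> = ennreal (r powr (c + 1) / (c + 1))"
    using nn_integral_has_integral_lebesgue'[OF _ has_integral_powr_from_0[of c r]] assms by simp
  finally show ?thesis .
qed

lemma nn_integral_abs_powr_symmetric:
  assumes "-1 < c" "0 \<le> m"
  shows "(\<integral>\<^sup>+t. ennreal (\<bar>t\<bar> powr c) * indicator {-m..m} t \<partial>lborel) \<le> ennreal (2 * (m powr (c + 1) / (c + 1)))"
proof -
  have refl: "(\<integral>\<^sup>+t. ennreal (\<bar>t\<bar> powr c) * indicator {-m..0} t \<partial>lborel) = (\<integral>\<^sup>+t. ennreal (\<bar>t\<bar> powr c) * indicator {0..m} t \<partial>lborel)"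
    by (subst nn_integral_real_affine[where c = "-1" and t = 0]) (auto simp: indicator_def intro!: nn_integral_cong)
  have "(\<integral>\<^sup>+t. ennreal (\<bar>t\<bar> powr c) * indicator {-m..m} t \<partial>lborel) \<le>
     (\<integral>\<^sup>+t. ennreal (\<bar>t\<bar> powr c) * indicator {-m..0} t + ennreal (\<bar>t\<bar> powr c) * indicator {0..m} t \<partial>lborel)"
    by (intro nn_integral_mono) (auto simp: indicator_def)
  also have "\<dots> = ennreal (m powr (c + 1) / (c + 1)) + ennreal (m powr (c + 1) / (c + 1))"
    using assms by (subst nn_integral_add) (auto simp: refl nn_integral_abs_powr_0)
  also have "\<dots> = ennreal (2 * (m powr (c + 1) / (c + 1)))"
    using assms by (simp flip: ennreal_plus)
  finally show ?thesis .
qed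

text \<open>Two regimes. If \<open>r < m / 2\<close>, the interval stays at distance at least
  \<open>m / 2\<close> from \<open>0\<close> and the integrand is comparable to
  \<open>m powr (d - 1)\<close>. Otherwise \<open>r\<close> is comparable to \<open>m\<close>, and
  the integral over \<open>{-m..m}\<close>, which equals \<open>2 * m powr d / d\<close>, is
  affordable; the unavoidable \<open>1 / d\<close> arises there.\<close>

lemma nn_integral_abs_powr_dual_le:
  fixes u r d :: real
  assumes d: "0 < d" "d < 1" and r: "0 < r"
  defines "m \<equiv> max \<bar>u\<bar> \<bar>u + r\<bar>"
  shows "(\<integral>\<^sup>+t. ennreal (\<bar>t\<bar> powr (d - 1)) * indicator {u..u + r} t \<partial>lborel) \<le> ennreal (r * (4 / d * m powr (d - 1)))"
proof -
  have m: "0 < m" "{u..u + r} \<subseteq> {-m..m}" using r by (auto simp: m_def)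
  show ?thesis
  proof (cases "r < m / 2")
    case True
    have "\<bar>t\<bar> powr (d - 1) \<le> 4 / d * m powr (d - 1)" if "t \<in> {u..u + r}" for t
    proof -
      have "m / 2 \<le> \<bar>t\<bar>" using that True r by (auto simp: m_def)
      then have "\<bar>t\<bar> powr (d - 1) \<le> (m / 2) powr (d - 1)"
        using m d by (intro powr_mono2') auto
      also have "\<dots> = 2 powr (1 - d) * m powr (d - 1)"
        using m by (simp add: powr_divide powr_diff)
      also have "2 powr (1 - d) \<le> 2 powr (1::real)"
        using d by (intro powr_mono) auto
      also have "(2::real) powr 1 \<le> 4 / d"
        using d by (simp add: field_simps)
      finally show ?thesis by (simp add: mult_right_mono)
    qed
    then have "(\<integral>\<^sup>+t. ennreal (\<bar>t\<bar> powr (d - 1)) * indicator {u..u + r} t \<partial>lborel) \<le>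
       (\<integral>\<^sup>+t. ennreal (4 / d * m powr (d - 1)) * indicator {u..u + r} t \<partial>lborel)"
      by (intro nn_integral_mono) (auto simp: indicator_def intro!: ennreal_leI)
    also have "\<dots> = ennreal (4 / d * m powr (d - 1)) * ennreal r"
      using r by (subst nn_integral_cmult_indicator) auto
    finally show ?thesis
      using d r by (simp add: mult.commute flip: ennreal_mult)
  next
    case False
    have "(\<integral>\<^sup>+t. ennreal (\<bar>t\<bar> powr (d - 1)) * indicator {u..u + r} t \<partial>lborel) \<le>
      (\<integral>\<^sup>+t. ennreal (\<bar>t\<bar> powr (d - 1)) * indicator {-m..m} t \<partial>lborel)"
      using m by (intro nn_integral_mono) (auto simp: indicator_def subset_iff)
    also have "\<dots> \<le> ennreal (2 * (m powr (d - 1 + 1) / (d - 1 + 1)))"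
      using m d by (intro nn_integral_abs_powr_symmetric) auto
    also have "\<dots> \<le> ennreal (r * (4 / d * m powr (d - 1)))"
    proof (rule ennreal_leI)
      have "2 * m powr d = 2 * m * m powr (d - 1)"
        using m by (simp add: powr_diff)
      also have "\<dots> \<le> r * 4 * m powr (d - 1)"
        using False by (intro mult_right_mono) auto
      finally show "2 * (m powr (d - 1 + 1) / (d - 1 + 1)) \<le> r * (4 / d * m powr (d - 1))"
        using d by (simp add: field_simps)
    qed
    finally show ?thesis .
  qed
qed

lemma nn_integral_abs_powr_le:
  fixes u r c :: real
  assumes c: "0 \<le> c" and r: "0 < r"
  shows "(\<integral>\<^sup>+t. ennreal (\<bar>t\<bar> powr c) * indicator {u..u + r} t \<partial>lborel) \<le> ennreal (r * max \<bar>u\<bar> \<bar>u + r\<bar> powr c)"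
proof -
  have "(\<integral>\<^sup>+t. ennreal (\<bar>t\<bar> powr c) * indicator {u..u + r} t \<partial>lborel) \<le>
      (\<integral>\<^sup>+t. ennreal (max \<bar>u\<bar> \<bar>u + r\<bar> powr c) * indicator {u..u + r} t \<partial>lborel)"
    using c by (intro nn_integral_mono) (auto simp: indicator_def intro!: ennreal_leI powr_mono2)
  also have "\<dots> = ennreal (max \<bar>u\<bar> \<bar>u + r\<bar> powr c) * ennreal r"
    using r by (subst nn_integral_cmult_indicator) auto
  finally show ?thesis
    using r by (simp add: mult.commute flip: ennreal_mult)
qed

section \<open>Power weights and their \<open>A_p\<close> constants\<close>

lemma avg_le:
  assumes [measurable]: "u \<in> borel_measurable lebesgue" "Q \<in> sets lebesgue" and nn: "\<And>x. 0 \<le> u x"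
    and Q: "measure lebesgue Q = m" "0 < m" and K: "0 \<le> K"
    and le: "(\<integral>\<^sup>+x. ennreal (u x) * indicator Q x \<partial>lebesgue) \<le> ennreal (m * K)"
  shows "set_integrable lebesgue Q u" "0 \<le> avg Q u" "avg Q u \<le> K"
proof -
  have eq: "(\<integral>\<^sup>+x. ennreal (indicator Q x *\<^sub>R u x) \<partial>lebesgue) = (\<integral>\<^sup>+x. ennreal (u x) * indicator Q x \<partial>lebesgue)"
    by (intro nn_integral_cong) (auto simp: indicator_def)
  have "(\<integral>\<^sup>+x. ennreal (indicator Q x *\<^sub>R u x) \<partial>lebesgue) < \<infinity>"
    unfolding eq using le by (rule le_less_trans) simp
  then show "set_integrable lebesgue Q u"
    unfolding set_integrable_def using nn by (intro integrableI_nonneg) auto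
  have "set_lebesgue_integral lebesgue Q u = enn2real (\<integral>\<^sup>+x. ennreal (u x) * indicator Q x \<partial>lebesgue)"
    unfolding set_lebesgue_integral_def eq[symmetric] using nn by (intro integral_eq_nn_integral) auto
  also have "\<dots> \<le> m * K"
    using le Q K by (intro enn2real_leI) auto
  finally show "avg Q u \<le> K"
    using Q by (simp add: avg_def field_simps)
  show "0 \<le> avg Q u"
    unfolding avg_def set_lebesgue_integral_def using Q nn by (auto intro!: divide_nonneg_pos integral_nonneg_AE)
qed

definition pow_weight :: "'a::euclidean_space \<Rightarrow> real \<Rightarrow> 'a \<Rightarrow> real" where
  "pow_weight e c x = \<bar>x \<bullet> e\<bar> powr c"

lemma borel_measurable_pow_weight [measurable]: "pow_weight e c \<in> borel_measurable lebesgue"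
  unfolding pow_weight_def by (intro measurable_completion) simp

lemma Ap_pow_weight:
  fixes e :: "'a::euclidean_space"
  assumes e: "e \<in> Basis" and d: "0 < d" "d < 1" and p: "1 < p"
  shows "Ap_weight p (pow_weight e ((p - 1) * (1 - d)))"
    and "Ap_const p (pow_weight e ((p - 1) * (1 - d))) \<le> (4 / d) powr (p - 1)"
proof -
  define c where "c = (p - 1) * (1 - d)"
  have c: "0 \<le> c" using d p by (simp add: c_def)
  let ?w = "pow_weight e c"
  have dual: "(\<lambda>x. ?w x powr (- 1 / (p - 1))) = pow_weight e (d - 1)"
  proof
    fix x
    have "c * (- 1 / (p - 1)) = d - 1" using p by (simp add: c_def field_simps)
    then show "?w x powr (- 1 / (p - 1)) = pow_weight e (d - 1) x"
      unfolding pow_weight_def powr_powr by (simp only:)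
  qed
  have cube: "set_integrable lebesgue Q ?w \<and> set_integrable lebesgue Q (pow_weight e (d - 1)) \<and>
      avg Q ?w * (avg Q (pow_weight e (d - 1))) powr (p - 1) \<le> (4 / d) powr (p - 1)" if Q: "is_cube Q" for Q
  proof -
    obtain a r where r: "0 < r" and Q: "Q = cbox a (a + r *\<^sub>R One)" using Q by (auto simp: is_cube_def)
    define m where "m = max \<bar>a \<bullet> e\<bar> \<bar>a \<bullet> e + r\<bar>"
    have m: "0 < m" using r by (auto simp: m_def)
    have Qm: "measure lebesgue Q = r ^ DIM('a)" "0 < r ^ DIM('a)"
      using r emeasure_cube[of r a] by (auto simp: Q measure_def)
    have [measurable]: "Q \<in> sets lebesgue" by (simp add: Q)
    have rr: "r ^ (DIM('a) - 1) * (r * K) = r ^ DIM('a) * K" for K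
      by (metis DIM_positive mult.assoc mult.commute power_minus_mult)
    have rr: "ennreal (r ^ (DIM('a) - 1)) * ennreal (r * K) = ennreal (r ^ DIM('a) * K)" if "0 \<le> K" for K
      unfolding rr[symmetric] using r that by (intro ennreal_mult[symmetric]) auto
    have coord: "(\<integral>\<^sup>+x. ennreal (pow_weight e q x) * indicator Q x \<partial>lebesgue) =
       ennreal (r ^ (DIM('a) - 1)) * (\<integral>\<^sup>+t. ennreal (\<bar>t\<bar> powr q) * indicator {a \<bullet> e..a \<bullet> e + r} t \<partial>lborel)" for q
      unfolding Q pow_weight_def using r by (intro nn_integral_cube_coord[OF e, of r "\<lambda>t. ennreal (\<bar>t\<bar> powr q)"]) auto
    have "(\<integral>\<^sup>+x. ennreal (?w x) * indicator Q x \<partial>lebesgue) \<le> ennreal (r ^ (DIM('a) - 1)) * ennreal (r * m powr c)"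
      unfolding coord m_def by (intro mult_left_mono nn_integral_abs_powr_le c r) auto
    also have "\<dots> = ennreal (r ^ DIM('a) * m powr c)"
      by (rule rr) simp
    finally have 1: "(\<integral>\<^sup>+x. ennreal (?w x) * indicator Q x \<partial>lebesgue) \<le> \<dots>" .
    have "(\<integral>\<^sup>+x. ennreal (pow_weight e (d - 1) x) * indicator Q x \<partial>lebesgue) \<le> ennreal (r ^ (DIM('a) - 1)) * ennreal (r * (4 / d * m powr (d - 1)))"
      unfolding coord m_def by (intro mult_left_mono nn_integral_abs_powr_dual_le d r) auto
    also have "\<dots> = ennreal (r ^ DIM('a) * (4 / d * m powr (d - 1)))"
      using d by (intro rr) simp
    finally have 2: "(\<integral>\<^sup>+x. ennreal (pow_weight e (d - 1) x) * indicator Q x \<partial>lebesgue) \<le> \<dots>" .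
    have W: "set_integrable lebesgue Q ?w" "0 \<le> avg Q ?w" "avg Q ?w \<le> m powr c"
      by (rule avg_le[OF _ _ _ Qm _ 1]; simp add: pow_weight_def[abs_def] borel_measurable_pow_weight[unfolded pow_weight_def[abs_def]])+
    have nn2: "0 \<le> 4 / d * m powr (d - 1)" using d by simp
    have S: "set_integrable lebesgue Q (pow_weight e (d - 1))" "0 \<le> avg Q (pow_weight e (d - 1))"
      "avg Q (pow_weight e (d - 1)) \<le> 4 / d * m powr (d - 1)"
      by (rule avg_le[OF _ _ _ Qm nn2 2]; simp add: pow_weight_def[abs_def] borel_measurable_pow_weight[unfolded pow_weight_def[abs_def]])+
    have "avg Q ?w * (avg Q (pow_weight e (d - 1))) powr (p - 1) \<le> m powr c * (4 / d * m powr (d - 1)) powr (p - 1)"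
      using W S p by (intro mult_mono powr_mono2) auto
    also have "\<dots> = m powr c * m powr ((d - 1) * (p - 1)) * (4 / d) powr (p - 1)"
      using d by (subst powr_mult) (simp_all only: powr_powr mult_ac)
    also have "m powr c * m powr ((d - 1) * (p - 1)) = m powr (c + (d - 1) * (p - 1))"
      by (simp add: powr_add)
    \<comment> \<open>The powers of \<open>m\<close> cancel, so the bound does not depend on the
      position or the size of the cube.\<close>
    also have "c + (d - 1) * (p - 1) = 0" by (simp add: c_def algebra_simps)
    finally show ?thesis using W S m by simp
  qed
  have "negligible {x. e \<bullet> x = 0}"
    using e by (intro negligible_hyperplane) auto
  then have "AE x in lebesgue. x \<notin> {x. e \<bullet> x = 0}"
    unfolding negligible_iff_null_sets by (rule AE_not_in)
  then have pos: "AE x in lebesgue. 0 < ?w x"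
    by eventually_elim (simp add: pow_weight_def inner_commute)
  have bdd: "bdd_above {avg Q ?w * (avg Q (\<lambda>x. ?w x powr (- 1 / (p - 1)))) powr (p - 1) | Q. is_cube Q}"
    unfolding dual using cube by (intro bdd_aboveI[of _ "(4 / d) powr (p - 1)"]) auto
  have "Ap_weight p ?w"
    unfolding Ap_weight_def using pos bdd cube unfolding dual by auto
  moreover have "is_cube (cbox (0::'a) (0 + 1 *\<^sub>R One))"
    unfolding is_cube_def by (metis zero_less_one)
  then have "Ap_const p ?w \<le> (4 / d) powr (p - 1)"
    unfolding Ap_const_def dual using cube by (intro cSup_least) auto
  ultimately show "Ap_weight p (pow_weight e ((p - 1) * (1 - d)))"
    "Ap_const p (pow_weight e ((p - 1) * (1 - d))) \<le> (4 / d) powr (p - 1)"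
    by (simp_all add: c_def)
qed

text \<open>On the unit cube this is the dual weight of
  \<open>pow_weight e ((p - 1) * (1 - d))\<close>, for which
  \<open>\<sigma> powr p * w = \<sigma>\<close>. It is therefore as large as integrability near the
  hyperplane allows while \<open>d\<close> stays positive.\<close>

definition pow_fun :: "'a::euclidean_space \<Rightarrow> real \<Rightarrow> 'a \<Rightarrow> real" where
  "pow_fun e d x = \<bar>x \<bullet> e\<bar> powr (d - 1) * indicator (cbox 0 One) x"

text \<open>The function \<open>pow_fun\<close> is a sub-eigenfunction of the maximal operator with eigenvalue
  \<open>1 / d\<close>: average over a cube inside the unit cube that has a face on the hyperplane
  \<open>x \<bullet> e = 0\<close> and the opposite face through \<open>x\<close>.\<close>
lemma maximal_pow_fun:
  fixes e :: "'a::euclidean_space"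
  assumes e: "e \<in> Basis" and d: "0 < d" "d < 1" and c: "0 \<le> c"
    and G: "\<And>y. ennreal c * ennreal (pow_fun e d y) \<le> G y"
  shows "ennreal (c / d) * ennreal (pow_fun e d x) \<le> maximal G x"
proof (cases "x \<in> cbox 0 One \<and> x \<bullet> e \<noteq> 0")
  case True
  define r where "r = x \<bullet> e"
  have xb: "0 \<le> x \<bullet> b" "x \<bullet> b \<le> 1" if "b \<in> Basis" for b
    using True that by (auto simp: mem_box)
  have r: "0 < r" "r \<le> 1" using True xb[OF e] by (auto simp: r_def)
  \<comment> \<open>In direction \<open>e\<close> the cube runs from \<open>0\<close> to
    \<open>x \<bullet> e\<close>. In the other directions it starts at \<open>x\<close>, pushed back
    to \<open>1 - r\<close> where it would leave the unit cube.\<close>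
  define z where "z = (\<Sum>b\<in>Basis. (if b = e then 0 else min (x \<bullet> b) (1 - r)) *\<^sub>R b)"
  have z: "z \<bullet> b = (if b = e then 0 else min (x \<bullet> b) (1 - r))" if "b \<in> Basis" for b
    using that by (simp add: z_def)
  let ?Q = "cbox z (z + r *\<^sub>R One)"
  have xQ: "x \<in> ?Q"
    unfolding mem_cube
  proof
    fix b :: 'a assume b: "b \<in> Basis"
    show "z \<bullet> b \<le> x \<bullet> b \<and> x \<bullet> b \<le> z \<bullet> b + r"
      using xb[OF b] r b by (auto simp: z r_def)
  qed
  have sub: "?Q \<subseteq> cbox 0 One"
  proof
    fix y assume y: "y \<in> ?Q"
    show "y \<in> cbox 0 One"
      unfolding mem_box
    proof
      fix b :: 'a assume b: "b \<in> Basis"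
      have "z \<bullet> b \<le> y \<bullet> b" "y \<bullet> b \<le> z \<bullet> b + r"
        using y b by (auto simp: mem_cube)
      then show "0 \<bullet> b \<le> y \<bullet> b \<and> y \<bullet> b \<le> One \<bullet> b"
        using xb[OF b] r b by (auto simp: z split: if_splits)
    qed
  qed
  have rr: "r ^ (DIM('a) - 1) * (r * K) = r ^ DIM('a) * K" for K
    by (metis DIM_positive mult.assoc mult.commute power_minus_mult)
  have "(\<integral>\<^sup>+y. ennreal (\<bar>y \<bullet> e\<bar> powr (d - 1)) * indicator ?Q y \<partial>lebesgue) =
     ennreal (r ^ (DIM('a) - 1)) * (\<integral>\<^sup>+t. ennreal (\<bar>t\<bar> powr (d - 1)) * indicator {z \<bullet> e..z \<bullet> e + r} t \<partial>lborel)"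
    using r by (intro nn_integral_cube_coord[OF e, of r "\<lambda>t. ennreal (\<bar>t\<bar> powr (d - 1))"]) auto
  also have "\<dots> = ennreal (r ^ (DIM('a) - 1)) * ennreal (r powr (d - 1 + 1) / (d - 1 + 1))"
    using d r nn_integral_abs_powr_0[of "d - 1" r] by (simp add: z[OF e])
  also have "\<dots> = ennreal (r ^ (DIM('a) - 1) * (r * (r powr (d - 1) / d)))"
    using r d by (simp add: powr_diff flip: ennreal_mult)
  also have "\<dots> = ennreal (r ^ DIM('a) * (r powr (d - 1) / d))"
    unfolding rr ..
  finally have I: "(\<integral>\<^sup>+y. ennreal (\<bar>y \<bullet> e\<bar> powr (d - 1)) * indicator ?Q y \<partial>lebesgue) = ennreal (r ^ DIM('a) * (r powr (d - 1) / d))" .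
  have "ennreal c * ennreal (r ^ DIM('a) * (r powr (d - 1) / d)) =
      (\<integral>\<^sup>+y. ennreal c * (ennreal (\<bar>y \<bullet> e\<bar> powr (d - 1)) * indicator ?Q y) \<partial>lebesgue)"
    unfolding I[symmetric] by (intro nn_integral_cmult[symmetric] measurable_completion) auto
  also have "\<dots> \<le> (\<integral>\<^sup>+y. G y * indicator ?Q y \<partial>lebesgue)"
  proof (rule nn_integral_mono)
    fix y
    show "ennreal c * (ennreal (\<bar>y \<bullet> e\<bar> powr (d - 1)) * indicator ?Q y) \<le> G y * indicator ?Q y"
      using G[of y] sub by (auto simp: indicator_def pow_fun_def split: if_splits)
  qed
  finally have le: "ennreal (c * (r ^ DIM('a) * (r powr (d - 1) / d))) \<le> (\<integral>\<^sup>+y. G y * indicator ?Q y \<partial>lebesgue)"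
    unfolding ennreal_mult'[OF c] .
  have "ennreal (c / d) * ennreal (pow_fun e d x) = ennreal (c * (r ^ DIM('a) * (r powr (d - 1) / d))) / ennreal (r ^ DIM('a))"
    using True r c d by (simp add: pow_fun_def r_def divide_ennreal flip: ennreal_mult)
  also have "\<dots> \<le> (\<integral>\<^sup>+y. G y * indicator ?Q y \<partial>lebesgue) / emeasure lebesgue ?Q"
    unfolding emeasure_cube[OF less_imp_le[OF r(1)]] by (intro divide_right_mono_ennreal le)
  also have "\<dots> \<le> maximal G x"
    unfolding maximal_def is_cube_def using xQ r by (intro SUP_upper) auto
  finally show ?thesis .
\<comment> \<open>In the remaining case \<open>pow_fun e d x = 0\<close>: outside the unit cube by
  the indicator, on the hyperplane because \<open>0 powr (d - 1) = 0\<close>.\<close>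
qed (auto simp: pow_fun_def)

lemma maximal_iter_pow_fun:
  fixes e :: "'a::euclidean_space"
  assumes e: "e \<in> Basis" and d: "0 < d" "d < 1"
  shows "ennreal ((1 / d) ^ k) * ennreal (pow_fun e d x) \<le> maximal_iter k (pow_fun e d) x"
proof (induction k arbitrary: x)
  case 0
  show ?case by (simp add: maximal_iter_def ennreal_leI)
next
  case (Suc k)
  have "ennreal ((1 / d) ^ k / d) * ennreal (pow_fun e d x) \<le> maximal (maximal_iter k (pow_fun e d)) x"
    using d Suc.IH by (intro maximal_pow_fun e) auto
  then show ?case by (simp add: maximal_iter_def mult.commute)
qed

lemma nn_integral_unit_cube_powr:
  fixes e :: "'a::euclidean_space"
  assumes e: "e \<in> Basis" and q: "-1 < q"
  shows "(\<integral>\<^sup>+x. ennreal (\<bar>x \<bullet> e\<bar> powr q) * indicator (cbox 0 One) x \<partial>lebesgue) = ennreal (1 / (q + 1))"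
  using nn_integral_cube_coord[OF e, of 1 "\<lambda>t. ennreal (\<bar>t\<bar> powr q)" 0] nn_integral_abs_powr_0[OF q, of 1] by simp

text \<open>Almost everywhere on the unit cube \<open>pow_fun e d\<close> is at least 1, so the
  iterate is at least \<open>(1 / d) ^ k\<close>. The weight gives this cube mass at least
  \<open>1 / p\<close>, and the norm of the test function is
  \<open>(1 / d) powr (1 / p)\<close>.\<close>

lemma Mk_norm_pow_weight_ge:
  fixes e :: "'a::euclidean_space"
  assumes e: "e \<in> Basis" and d: "0 < d" "d < 1" and p: "1 < p"
  shows "ennreal ((1 / d) ^ k / 2 * (1 / p) powr (1 / p) * d powr (1 / p)) \<le> Mk_norm p k (pow_weight e ((p - 1) * (1 - d)))"
proof -
  define c where "c = (p - 1) * (1 - d)"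
  have "c \<le> (p - 1) * 1"
    unfolding c_def using d p by (intro mult_left_mono) auto
  moreover have "0 \<le> c"
    using d p by (simp add: c_def)
  ultimately have c: "0 \<le> c" "c + 1 \<le> p"
    by auto
  let ?w = "pow_weight e c" and ?f = "pow_fun e d"
  have "(\<integral>\<^sup>+ x. ennreal (\<bar>?f x\<bar> powr p * ?w x) \<partial>lebesgue) = (\<integral>\<^sup>+x. ennreal (\<bar>x \<bullet> e\<bar> powr (d - 1)) * indicator (cbox 0 One) x \<partial>lebesgue)"
  proof (rule nn_integral_cong)
    fix x
    have "(d - 1) * p + c = d - 1" by (simp add: c_def algebra_simps)
    then have "(\<bar>x \<bullet> e\<bar> powr (d - 1)) powr p * \<bar>x \<bullet> e\<bar> powr c = \<bar>x \<bullet> e\<bar> powr (d - 1)"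
      by (simp only: powr_powr powr_add[symmetric])
    then show "ennreal (\<bar>?f x\<bar> powr p * ?w x) = ennreal (\<bar>x \<bullet> e\<bar> powr (d - 1)) * indicator (cbox 0 One) x"
      by (auto simp: pow_fun_def pow_weight_def indicator_def)
  qed
  then have Lp: "Lp_norm p ?w ?f = ennreal ((1 / d) powr (1 / p))"
    using d nn_integral_unit_cube_powr[OF e, of "d - 1"] by (simp add: Lp_norm_def enn_powr_ennreal)
  have meas: "?f \<in> borel_measurable lebesgue"
    unfolding pow_fun_def[abs_def] by (intro measurable_completion) simp
  \<comment> \<open>Half of the lower bound, to make the inequality defining the level set
    strict.\<close>
  define T where "T = (1 / d) ^ k / 2"
  have T: "0 < T" "T < (1 / d) ^ k" using d by (auto simp: T_def)
  have "ennreal (1 / p) \<le> ennreal (1 / (c + 1))"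
    using c p by (intro ennreal_leI) (simp add: field_simps)
  also have "\<dots> = (\<integral>\<^sup>+x. ennreal (\<bar>x \<bullet> e\<bar> powr c) * indicator (cbox 0 One) x \<partial>lebesgue)"
    using c by (intro nn_integral_unit_cube_powr[OF e, symmetric]) auto
  also have "\<dots> \<le> wmeasure ?w {x. ennreal T < maximal_iter k ?f x}"
    unfolding wmeasure_def
  proof (rule nn_integral_mono)
    fix x
    show "ennreal (\<bar>x \<bullet> e\<bar> powr c) * indicator (cbox 0 One) x \<le> ennreal (?w x) * indicator {x. ennreal T < maximal_iter k ?f x} x"
    proof (cases "x \<in> cbox 0 One \<and> x \<bullet> e \<noteq> 0")
      case True
      then have "0 < \<bar>x \<bullet> e\<bar>" "\<bar>x \<bullet> e\<bar> \<le> 1" using e by (auto simp: mem_box abs_le_iff)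
      then have "1 \<le> ?f x"
        using d True powr_mono2'[of "d - 1" "\<bar>x \<bullet> e\<bar>" 1] by (simp add: pow_fun_def)
      then have "(1 / d) ^ k * 1 \<le> (1 / d) ^ k * ?f x"
        using d by (intro mult_left_mono) auto
      then have "T < (1 / d) ^ k * ?f x" using T by linarith
      then have "ennreal T < ennreal ((1 / d) ^ k) * ennreal (?f x)"
        using d T by (subst ennreal_mult'[symmetric]) (auto intro: ennreal_lessI)
      also have "\<dots> \<le> maximal_iter k ?f x" by (rule maximal_iter_pow_fun[OF e d])
      finally show ?thesis by (simp add: pow_weight_def indicator_def)
    qed auto
  qed
  finally have wm: "ennreal (1 / p) \<le> wmeasure ?w {x. ennreal T < maximal_iter k ?f x}" .
  have "ennreal (T * (1 / p) powr (1 / p)) = ennreal T * enn_powr (ennreal (1 / p)) (1 / p)"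
    using T p by (simp add: enn_powr_ennreal ennreal_mult)
  also have "\<dots> \<le> ennreal T * enn_powr (wmeasure ?w {x. ennreal T < maximal_iter k ?f x}) (1 / p)"
    using p by (intro mult_left_mono enn_powr_mono wm) auto
  also have "\<dots> \<le> weak_norm p ?w (maximal_iter k ?f)"
    unfolding weak_norm_def using T by (intro SUP_upper) auto
  finally have "ennreal (T * (1 / p) powr (1 / p)) / Lp_norm p ?w ?f \<le> weak_norm p ?w (maximal_iter k ?f) / Lp_norm p ?w ?f"
    by (rule divide_right_mono_ennreal)
  also have "\<dots> \<le> Mk_norm p k ?w"
    unfolding Mk_norm_def using meas d by (intro SUP_upper) (auto simp: Lp)
  finally have "ennreal (T * (1 / p) powr (1 / p)) / ennreal ((1 / d) powr (1 / p)) \<le> Mk_norm p k ?w"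
    unfolding Lp .
  moreover have "ennreal (T * (1 / p) powr (1 / p)) / ennreal ((1 / d) powr (1 / p)) =
      ennreal (T * (1 / p) powr (1 / p) * d powr (1 / p))"
    using d T by (subst divide_ennreal) (simp_all add: powr_divide)
  ultimately show ?thesis
    by (simp add: T_def c_def)
qed

section \<open>Comparison of exponents\<close>

lemma powr_bounded_exponent:
  fixes a b C D :: real
  assumes C: "0 < C" and D: "0 < D" and le: "\<And>X. 1 < X \<Longrightarrow> C * X powr a \<le> D * X powr b"
  shows "a \<le> b"
proof (rule ccontr)
  assume "\<not> a \<le> b"
  then have ab: "0 < a - b" by simp
  \<comment> \<open>Chosen so that \<open>X powr (a - b) = 1 + D / C\<close>, just above the ratio
    that the assumption permits.\<close>
  define X where "X = (1 + D / C) powr (1 / (a - b))"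
  have X: "1 < X" unfolding X_def using ab C D by (intro gr_one_powr) auto
  have "X powr a = X powr b * X powr (a - b)"
    by (simp add: powr_add[symmetric])
  also have "X powr (a - b) = 1 + D / C"
    using ab C D by (simp add: X_def powr_powr add_pos_pos)
  finally have "C * X powr a = (C + D) * X powr b"
    using C by (simp add: field_simps)
  with le[OF X] have "(C + D) * X powr b \<le> D * X powr b" by simp
  then show False using X C by (simp add: mult_le_cancel_right)
qed

lemma Mk_norm_exponent_ge:
  fixes p \<beta> c :: real
  assumes p: "1 < p" and \<beta>: "0 < \<beta>" and c: "0 < c"
    and bound: "\<And>w :: 'a::euclidean_space \<Rightarrow> real. Ap_weight p w \<Longrightarrow> Mk_norm p k w \<le> ennreal (c * Ap_const p w powr \<beta>)"
  shows "(real k - 1) / (p - 1) \<le> \<beta>"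
proof -
  obtain e :: 'a where e: "e \<in> Basis" using nonempty_Basis by blast
  have "(1 / 2 * (1 / p) powr (1 / p)) * X powr (real k - 1 / p) \<le> (c * 4 powr ((p - 1) * \<beta>)) * X powr ((p - 1) * \<beta>)"
    if X: "1 < X" for X
  proof -
    define d where "d = 1 / X"
    have d: "0 < d" "d < 1" "1 / d = X" using X by (auto simp: d_def)
    let ?w = "pow_weight e ((p - 1) * (1 - d))"
    note A = Ap_pow_weight[OF e d(1,2) p]
    have A0: "0 \<le> Ap_const p ?w"
      using Ap_const_pos[OF A(1) p] by simp
    have "ennreal ((1 / d) ^ k / 2 * (1 / p) powr (1 / p) * d powr (1 / p)) \<le> ennreal (c * Ap_const p ?w powr \<beta>)"
      using Mk_norm_pow_weight_ge[OF e d(1,2) p, of k] bound[OF A(1)] by (rule order_trans)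
    \<comment> \<open>An upper estimate of the \<open>A_p\<close> constant suffices, since
      \<open>\<beta> > 0\<close> makes the right side increasing in it.\<close>
    also have "\<dots> \<le> ennreal (c * ((4 / d) powr (p - 1)) powr \<beta>)"
      using A(2) A0 \<beta> c by (intro ennreal_leI mult_left_mono powr_mono2) auto
    finally have le: "(1 / d) ^ k / 2 * (1 / p) powr (1 / p) * d powr (1 / p) \<le> c * ((4 / d) powr (p - 1)) powr \<beta>"
      using c by (simp add: ennreal_le_iff)
    have "d powr (1 / p) = X powr (- 1 / p)"
      using X by (simp add: d_def powr_divide powr_minus_divide)
    then have "(1 / d) ^ k * d powr (1 / p) = X powr (real k - 1 / p)"
      using X d(3) by (simp add: powr_realpow[symmetric] powr_add[symmetric])
    then have "(1 / d) ^ k / 2 * (1 / p) powr (1 / p) * d powr (1 / p) = (1 / 2 * (1 / p) powr (1 / p)) * X powr (real k - 1 / p)"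
      by simp
    moreover have "((4 / d) powr (p - 1)) powr \<beta> = 4 powr ((p - 1) * \<beta>) * X powr ((p - 1) * \<beta>)"
      using X by (simp add: d_def powr_powr powr_mult)
    ultimately show ?thesis
      using le by (simp only: mult.assoc)
  qed
  then have "real k - 1 / p \<le> (p - 1) * \<beta>"
    by (rule powr_bounded_exponent[rotated 2]) (use p c in simp_all)
  \<comment> \<open>Weakens the exponent \<open>k - 1 / p\<close> that was obtained to the claimed
    \<open>k - 1\<close>.\<close>
  moreover have "1 / p \<le> 1" using p by simp
  ultimately have "real k - 1 \<le> (p - 1) * \<beta>" by linarith
  then show ?thesis using p by (simp add: pos_divide_le_eq mult.commute)
qed

theorem theorem1p3:
  fixes p :: real and k :: nat
  assumes "1 < p" and "1 \<le> k"
  shows "(\<exists>c>0. \<forall>w :: 'a::euclidean_space \<Rightarrow> real. Ap_weight p w \<longrightarrow>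
            Mk_norm p k w \<le> ennreal (c * Ap_const p w powr (1 / p + (real k - 1) / (p - 1))))
       \<and> (\<forall>\<beta> c. 0 < \<beta> \<longrightarrow> 0 < c \<longrightarrow>
            (\<forall>w :: 'a \<Rightarrow> real. Ap_weight p w \<longrightarrow> Mk_norm p k w \<le> ennreal (c * Ap_const p w powr \<beta>))
            \<longrightarrow> (real k - 1) / (p - 1) \<le> \<beta>)"
proof (intro conjI allI impI)
  have "0 < (weak_const DIM('a) p * strong_const DIM('a) p ^ (k - 1)) powr (1 / p)"
    using weak_const_pos[OF assms(1), of "DIM('a)"] strong_const_pos[OF assms(1), of "DIM('a)"] by simp
  then show "\<exists>c>0. \<forall>w :: 'a \<Rightarrow> real. Ap_weight p w \<longrightarrow>
      Mk_norm p k w \<le> ennreal (c * Ap_const p w powr (1 / p + (real k - 1) / (p - 1)))"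
    using Mk_norm_le[OF _ assms] by blast
next
  fix \<beta> c :: real
  assume "0 < \<beta>" "0 < c"
    "\<forall>w :: 'a \<Rightarrow> real. Ap_weight p w \<longrightarrow> Mk_norm p k w \<le> ennreal (c * Ap_const p w powr \<beta>)"
  then show "(real k - 1) / (p - 1) \<le> \<beta>"
    by (intro Mk_norm_exponent_ge[where 'a = 'a and c = c, OF assms(1)]) auto
qed

end
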